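(* Let $1\le r\le s\le t$ and $n=r+s+t+1$. Then the $(2r+2)$-wide diameter of $E3C(r,s,t)$ satisfies $D_{2r+2}(E3C(r,s,t))\le r+s+t+6=n+5$.
   Context: The exchanged 3-ary $n$-cube $E3C(r,s,t)$ ($r,s,t\ge1$, $n=r+s+t+1$): vertices are strings written $x=ABCd$ with $A\in\{0,1,2\}^r$, $B\in\{0,1,2\}^s$, $C\in\{0,1,2\}^t$, $d\in\{0,1,2\}$. Two distinct vertices $x=ABCd$, $y=A'B'C'd'$ are adjacent iff one of: (E0) $A=A',B=B',C=C'$ and $d\ne d'$; (E1) $d=d'=0$, $A=A'$, $B=B'$ and $C,C'$ differ in exactly one position; (E2) $d=d'=1$, $A=A'$, $C=C'$ and $B,B'$ differ in exactly one position; (E3) $d=d'=2$, $B=B'$, $C=C'$ and $A,A'$ differ in exactly one position. For a graph $G$ and positive integer $\beta\le\kappa(G)$ (vertex connectivity), the $\beta$-wide diameter $D_\beta(G)$ is the maximum over distinct $u,v\in V(G)$ of the minimum, over all families of $\beta$ pairwise internally disjoint $u$–$v$ paths, of the maximum length of a path in the family. (It is known that $\kappa(E3C(r,s,t))=2r+2$ when $r\le s\le t$.) *)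

theory Defs
  imports Main
begin

definition is_path :: "'a set \<Rightarrow> ('a \<Rightarrow> 'a \<Rightarrow> bool) \<Rightarrow> 'a \<Rightarrow> 'a \<Rightarrow> 'a list \<Rightarrow> bool" where
  "is_path V adj u v p \<longleftrightarrow> p \<noteq> [] \<and> hd p = u \<and> last p = v \<and> distinct p \<and> set p \<subseteq> V \<and>
     (\<forall>i. Suc i < length p \<longrightarrow> adj (p ! i) (p ! Suc i))"

definition path_len :: "'a list \<Rightarrow> nat" where
  "path_len p = length p - 1"

definition interior :: "'a list \<Rightarrow> 'a set" where
  "interior p = set (butlast (tl p))"

definition disjoint_family_paths ::
  "'a set \<Rightarrow> ('a \<Rightarrow> 'a \<Rightarrow> bool) \<Rightarrow> nat \<Rightarrow> 'a \<Rightarrow> 'a \<Rightarrow> (nat \<Rightarrow> 'a list) \<Rightarrow> bool" where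
  "disjoint_family_paths V adj \<beta> u v P \<longleftrightarrow>
     (\<forall>i<\<beta>. is_path V adj u v (P i)) \<and> inj_on P {..<\<beta>} \<and>
     (\<forall>i<\<beta>. \<forall>j<\<beta>. i \<noteq> j \<longrightarrow> interior (P i) \<inter> interior (P j) = {})"

definition family_len :: "nat \<Rightarrow> (nat \<Rightarrow> 'a list) \<Rightarrow> nat" where
  "family_len \<beta> P = Max ((\<lambda>i. path_len (P i)) ` {..<\<beta>})"

definition wide_diameter :: "'a set \<Rightarrow> ('a \<Rightarrow> 'a \<Rightarrow> bool) \<Rightarrow> nat \<Rightarrow> nat" where
  "wide_diameter V adj \<beta> =
     Max {Min {family_len \<beta> P | P. disjoint_family_paths V adj \<beta> u v P} | u v.
            u \<in> V \<and> v \<in> V \<and> u \<noteq> v}"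

text \<open>Vertex ABCd is represented as the tuple (A,B,C,d) of ternary lists of lengths r,s,t
  and a digit d in {0,1,2}.\<close>

type_synonym e3c_vertex = "nat list \<times> nat list \<times> nat list \<times> nat"

definition ternary :: "nat \<Rightarrow> nat list \<Rightarrow> bool" where
  "ternary k A \<longleftrightarrow> length A = k \<and> (\<forall>x\<in>set A. x < 3)"

definition E3C_vertices :: "nat \<Rightarrow> nat \<Rightarrow> nat \<Rightarrow> e3c_vertex set" where
  "E3C_vertices r s t = {(A, B, C, d). ternary r A \<and> ternary s B \<and> ternary t C \<and> d < 3}"

definition differ_in_one :: "nat list \<Rightarrow> nat list \<Rightarrow> bool" where
  "differ_in_one A A' \<longleftrightarrow> length A = length A' \<and> card {i. i < length A \<and> A ! i \<noteq> A' ! i} = 1"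

definition E3C_adj :: "nat \<Rightarrow> nat \<Rightarrow> nat \<Rightarrow> e3c_vertex \<Rightarrow> e3c_vertex \<Rightarrow> bool" where
  "E3C_adj r s t x y \<longleftrightarrow> x \<in> E3C_vertices r s t \<and> y \<in> E3C_vertices r s t \<and> x \<noteq> y \<and>
     (case x of (A, B, C, d) \<Rightarrow> case y of (A', B', C', d') \<Rightarrow>
        (A = A' \<and> B = B' \<and> C = C' \<and> d \<noteq> d')
      \<or> (d = 0 \<and> d' = 0 \<and> A = A' \<and> B = B' \<and> differ_in_one C C')
      \<or> (d = 1 \<and> d' = 1 \<and> A = A' \<and> C = C' \<and> differ_in_one B B')
      \<or> (d = 2 \<and> d' = 2 \<and> B = B' \<and> C = C' \<and> differ_in_one A A'))"

end

theory Submission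
  imports Defs
begin

text \<open>
  By exchanging layers we may take the two vertices in layers \<open>0, 0\<close> or \<open>0, 1\<close>. A path moves
  \<open>C\<close> in layer \<open>0\<close>, \<open>B\<close> in layer \<open>1\<close> and \<open>A\<close> in layer \<open>2\<close>; traversing each string at most once costs
  \<open>r + s + t\<close>, which leaves six further steps for switching layers and for detours. The Hamming graph
  of ternary strings of length \<open>m\<close> has diameter \<open>m\<close> and joins any two distinct vertices by \<open>2 m\<close>
  internally disjoint paths of length at most \<open>m + 1\<close>. Sending \<open>2 k\<close> paths through distinct
  neighbours of \<open>C\<close>, and two more through the layer switches, gives explicit families; which of the three
  strings agree determines the shape of the family.
\<close>

section \<open>Bounded paths inside a vertex set\<close>

text \<open>Each layer moves only one string, so inside a layer a leg is described by the two
  strings that stay fixed. The support of a path can therefore be given as a union of lines or parts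
  of lines, and disjointness of two supports mostly reduces to a fixed string that tells them apart
  in each layer; no path has to be listed vertex by vertex. The obstacle lies at the two ends: there
  the paths share the same fixed strings, and the disjoint Hamming paths or distinct neighbours must
  separate them. The six further steps are used up when the ends lie in layers 0 and 1 and the
  strings A differ. A path that leaves through the neighbour \<open>c i\<close> of \<open>C\<close>
  and arrives through a neighbour \<open>b i\<close> of \<open>B'\<close> visits the layers 0, 2, 1,
  0, 1, which takes four switches, and pays one step onto \<open>c i\<close> and one step from
  \<open>b i\<close> to \<open>B'\<close>.\<close>

definition reach :: "('a \<Rightarrow> 'a \<Rightarrow> bool) \<Rightarrow> 'a set \<Rightarrow> nat \<Rightarrow> 'a \<Rightarrow> 'a \<Rightarrow> bool" where
  "reach adj S n x y \<longleftrightarrow> (\<exists>p. is_path S adj x y p \<and> path_len p \<le> n)"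

lemma reach_refl: "x \<in> S \<Longrightarrow> reach adj S n x x"
  unfolding reach_def by (rule exI[of _ "[x]"]) (auto simp: is_path_def path_len_def)

lemma is_path_take:
  assumes "is_path S adj x y (p1 @ z # p2)"
  shows "is_path S adj x z (p1 @ [z])"
proof -
  have "adj ((p1 @ [z]) ! i) ((p1 @ [z]) ! Suc i)" if "Suc i < length (p1 @ [z])" for i
  proof -
    have "(p1 @ [z]) ! j = (p1 @ z # p2) ! j" if "j < length (p1 @ [z])" for j
      using that by (auto simp: nth_append)
    then show ?thesis using assms that by (simp add: is_path_def)
  qed
  moreover have "hd (p1 @ [z]) = x"
    using assms by (cases p1) (auto simp: is_path_def)
  ultimately show ?thesis using assms by (auto simp: is_path_def)
qed

lemma is_path_snoc:
  assumes "is_path S adj x y p" "adj y z" "z \<in> S" "z \<notin> set p"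
  shows "is_path S adj x z (p @ [z])"
proof -
  have "adj ((p @ [z]) ! i) ((p @ [z]) ! Suc i)" if "Suc i < length (p @ [z])" for i
  proof (cases "Suc i < length p")
    case True
    then show ?thesis using assms(1) by (simp add: is_path_def nth_append)
  next
    case False
    with that have i: "Suc i = length p" by simp
    then have "p ! i = last p" using assms(1) by (metis is_path_def last_conv_nth diff_Suc_1)
    then show ?thesis using assms i by (auto simp: is_path_def nth_append)
  qed
  then show ?thesis using assms by (auto simp: is_path_def)
qed

text \<open>If \<open>z\<close> was met before, the path is cut back to it. This is what allows legs
  to be concatenated freely although \<open>is_path\<close> demands distinct vertices.\<close>

lemma reach_step:
  assumes "reach adj S n x y" "adj y z" "z \<in> S"
  shows "reach adj S (Suc n) x z"
proof -
  obtain p where p: "is_path S adj x y p" "path_len p \<le> n" using assms(1) by (auto simp: reach_def)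
  have ne: "p \<noteq> []" using p by (simp add: is_path_def)
  show ?thesis
  proof (cases "z \<in> set p")
    case True
    then obtain p1 p2 where e: "p = p1 @ z # p2" by (meson split_list)
    have "is_path S adj x z (p1 @ [z])" using p(1) is_path_take e by metis
    moreover have "path_len (p1 @ [z]) \<le> Suc n" using p(2) e by (simp add: path_len_def)
    ultimately show ?thesis by (auto simp: reach_def)
  next
    case False
    then have "is_path S adj x z (p @ [z])" using is_path_snoc p(1) assms(2,3) by metis
    moreover have "path_len (p @ [z]) \<le> Suc n" using p(2) ne by (cases p) (auto simp: path_len_def)
    ultimately show ?thesis by (auto simp: reach_def)
  qed
qed

lemma is_path_singleton: "is_path S adj x y [z] \<longleftrightarrow> x = z \<and> y = z \<and> z \<in> S"
  by (auto simp: is_path_def)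

lemma is_path_Cons_Cons:
  "is_path S adj x y (z # w # p) \<longleftrightarrow>
     x = z \<and> z \<in> S \<and> z \<noteq> w \<and> z \<notin> set p \<and> adj z w \<and> is_path S adj w y (w # p)"
proof -
  have "(\<forall>i. Suc i < length (z # w # p) \<longrightarrow> adj ((z # w # p) ! i) ((z # w # p) ! Suc i)) \<longleftrightarrow>
     adj z w \<and> (\<forall>i. Suc i < length (w # p) \<longrightarrow> adj ((w # p) ! i) ((w # p) ! Suc i))"
    (is "(\<forall>i. ?P i) \<longleftrightarrow> _ \<and> (\<forall>i. ?Q i)")
  proof (intro iffI conjI allI)
    fix i assume a: "adj z w \<and> (\<forall>i. ?Q i)"
    then show "?P i" by (cases i) auto
  next
    assume a: "\<forall>i. ?P i"
    show "adj z w" using spec[OF a, of 0] by simp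
    show "?Q i" for i using spec[OF a, of "Suc i"] by simp
  qed
  then show ?thesis unfolding is_path_def by auto
qed

text \<open>The second path is fed edge by edge into \<open>reach_step\<close>, which removes every
  loop that arises where the two paths meet.\<close>

lemma reach_trans:
  assumes "reach adj S m x y" "reach adj S n y z"
  shows "reach adj S (m + n) x z"
proof -
  obtain q where "is_path S adj y z q" "path_len q \<le> n" using assms(2) by (auto simp: reach_def)
  then show ?thesis using assms(1)
  proof (induction q arbitrary: y m n)
    case Nil
    then show ?case by (simp add: is_path_def)
  next
    case (Cons a q)
    show ?case
    proof (cases q)
      case Nil
      then show ?thesis using Cons.prems
        by (auto simp: is_path_singleton reach_def intro: trans_le_add1)
    next
      case (Cons w q')
      have h: "y = a" "adj y w" "is_path S adj w z q"
        using Cons.prems(1) by (auto simp: Cons is_path_Cons_Cons)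
      have "w \<in> S" using h(3) by (auto simp: is_path_def Cons)
      then have 1: "reach adj S (Suc m) x w" using reach_step Cons.prems(3) h by metis
      obtain n' where n': "n = Suc n'" "path_len q \<le> n'"
        using Cons.prems(2) by (cases n) (auto simp: path_len_def Cons)
      show ?thesis using Cons.IH[OF h(3) n'(2) 1] n'(1) by simp
    qed
  qed
qed

lemma reach_mono:
  assumes "reach adj S m x y" "S \<subseteq> T" "m \<le> n"
  shows "reach adj T n x y"
proof -
  obtain p where "is_path S adj x y p" "path_len p \<le> m" using assms(1) by (auto simp: reach_def)
  then have "is_path T adj x y p" "path_len p \<le> n" using assms(2,3) by (auto simp: is_path_def)
  then show ?thesis by (auto simp: reach_def)
qed

lemma reach_edge: "adj x y \<Longrightarrow> x \<in> S \<Longrightarrow> y \<in> S \<Longrightarrow> reach adj S (Suc 0) x y"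
  using reach_step[OF reach_refl] by metis

lemma reach_start: "reach adj S n x y \<Longrightarrow> x \<in> S"
  by (auto simp: reach_def is_path_def dest!: hd_in_set)

lemma reach_Cons:
  assumes "adj x y" "x \<in> S" "reach adj S n y z"
  shows "reach adj S (Suc n) x z"
proof -
  have "y \<in> S" using assms(3) by (auto simp: reach_def is_path_def)
  then have "reach adj S (Suc 0) x y" using assms reach_edge by metis
  then show ?thesis using reach_trans assms(3) by fastforce
qed

lemma reach_map:
  assumes "reach adj S n x y"
    and step: "\<And>x y. x \<in> S \<Longrightarrow> y \<in> S \<Longrightarrow> adj x y \<Longrightarrow> adj' (f x) (f y)"
    and mem: "\<And>x. x \<in> S \<Longrightarrow> f x \<in> T"
  shows "reach adj' T n (f x) (f y)"
proof -
  obtain p where "is_path S adj x y p" "path_len p \<le> n" using assms(1) by (auto simp: reach_def)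
  then show ?thesis
  proof (induction p arbitrary: x n)
    case Nil
    then show ?case by (simp add: is_path_def)
  next
    case (Cons a q)
    show ?case
    proof (cases q)
      case Nil
      then show ?thesis using Cons.prems mem by (auto simp: is_path_singleton intro: reach_refl)
    next
      case (Cons w q')
      have h: "x = a" "adj x w" "is_path S adj w y q" "x \<in> S"
        using Cons.prems(1) by (auto simp: Cons is_path_Cons_Cons)
      have w: "w \<in> S" using h(3) by (auto simp: is_path_def Cons)
      obtain n' where n': "n = Suc n'" "path_len q \<le> n'"
        using Cons.prems(2) by (cases n) (auto simp: path_len_def Cons)
      show ?thesis using Cons.IH[OF h(3) n'(2)] n'(1) step[OF h(4) w h(2)] mem h reach_Cons by metis
    qed
  qed
qed

lemma is_path_rev:
  assumes "\<And>x y. adj x y \<Longrightarrow> adj y x" "is_path S adj x y p"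
  shows "is_path S adj y x (rev p)"
proof -
  have "adj (rev p ! i) (rev p ! Suc i)" if "Suc i < length p" for i
  proof -
    have "Suc (length p - Suc (Suc i)) < length p" using that by simp
    then have "adj (p ! (length p - Suc (Suc i))) (p ! Suc (length p - Suc (Suc i)))"
      using assms(2) unfolding is_path_def by blast
    moreover have "Suc (length p - Suc (Suc i)) = length p - Suc i" using that by simp
    ultimately show ?thesis using that assms(1) by (simp add: rev_nth)
  qed
  then show ?thesis using assms(2) by (auto simp: is_path_def hd_rev last_rev)
qed

lemma reach_sym:
  assumes "\<And>x y. adj x y \<Longrightarrow> adj y x" "reach adj S n x y"
  shows "reach adj S n y x"
  using assms is_path_rev unfolding reach_def path_len_def by (metis length_rev)

section \<open>Families of internally disjoint paths\<close>

definition weak_link :: "'a set \<Rightarrow> ('a \<Rightarrow> 'a \<Rightarrow> bool) \<Rightarrow> nat \<Rightarrow> 'a \<Rightarrow> 'a \<Rightarrow> 'a set \<Rightarrow> bool" where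
  "weak_link V adj L u v S \<longleftrightarrow> (\<exists>p. is_path V adj u v p \<and> path_len p \<le> L \<and> interior p \<subseteq> S)"

definition link :: "'a set \<Rightarrow> ('a \<Rightarrow> 'a \<Rightarrow> bool) \<Rightarrow> nat \<Rightarrow> 'a \<Rightarrow> 'a \<Rightarrow> 'a set \<Rightarrow> bool" where
  "link V adj L u v S \<longleftrightarrow>
     (\<exists>p. is_path V adj u v p \<and> path_len p \<le> L \<and> interior p \<subseteq> S \<and> interior p \<noteq> {})"

lemma link_imp_weak_link: "link V adj L u v S \<Longrightarrow> weak_link V adj L u v S"
  by (auto simp: link_def weak_link_def)

definition widely_linked :: "'a set \<Rightarrow> ('a \<Rightarrow> 'a \<Rightarrow> bool) \<Rightarrow> nat \<Rightarrow> nat \<Rightarrow> 'a \<Rightarrow> 'a \<Rightarrow> bool" where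
  "widely_linked V adj \<beta> L u v \<longleftrightarrow>
     (\<exists>P. disjoint_family_paths V adj \<beta> u v P \<and> (\<forall>i<\<beta>. path_len (P i) \<le> L))"

lemma interior_rev: "interior (rev p) = interior p"
  unfolding interior_def by (metis butlast_rev butlast_tl rev_rev_ident set_rev)

lemma interior_map: "interior (map f p) = f ` interior p"
  unfolding interior_def by (simp add: map_tl[symmetric] map_butlast[symmetric])

text \<open>Only one member may have empty interior: otherwise the edge from \<open>u\<close> to \<open>v\<close> would be
  counted twice.\<close>

lemma widely_linkedI:
  assumes weak: "\<And>i. i < \<beta> \<Longrightarrow> weak_link V adj L u v (S i)"
    and strong: "\<And>i. 0 < i \<Longrightarrow> i < \<beta> \<Longrightarrow> link V adj L u v (S i)"
    and disj: "\<And>i j. i < j \<Longrightarrow> j < \<beta> \<Longrightarrow> S i \<inter> S j = {}"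
  shows "widely_linked V adj \<beta> L u v"
proof -
  have "\<forall>i. \<exists>p. i < \<beta> \<longrightarrow> is_path V adj u v p \<and> path_len p \<le> L \<and> interior p \<subseteq> S i \<and>
      (0 < i \<longrightarrow> interior p \<noteq> {})"
    using weak strong unfolding weak_link_def link_def by (metis gr0I)
  then obtain P where P: "\<And>i. i < \<beta> \<Longrightarrow> is_path V adj u v (P i) \<and> path_len (P i) \<le> L \<and>
      interior (P i) \<subseteq> S i \<and> (0 < i \<longrightarrow> interior (P i) \<noteq> {})"
    by metis
  have d: "interior (P i) \<inter> interior (P j) = {}" if "i < j" "j < \<beta>" for i j
    using P[of i] P[of j] disj[OF that] that by fastforce
  \<comment> \<open>Equality would make the interior of \<open>P j\<close> disjoint from itself,
    hence empty, which \<open>0 < j\<close> excludes.\<close>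
  have ne: "P i \<noteq> P j" if "i < j" "j < \<beta>" for i j
    using d[OF that] P[of j] that by auto
  have "inj_on P {..<\<beta>}"
    using ne by (intro inj_onI) (metis lessThan_iff linorder_neqE_nat)
  moreover have "interior (P i) \<inter> interior (P j) = {}" if "i < \<beta>" "j < \<beta>" "i \<noteq> j" for i j
    using d[of i j] d[of j i] that by (cases "i < j") auto
  ultimately show ?thesis
    unfolding widely_linked_def disjoint_family_paths_def using P by (intro exI[of _ P]) auto
qed

lemma widely_linked_sym:
  assumes sym: "\<And>x y. adj x y \<Longrightarrow> adj y x" and "widely_linked V adj \<beta> L u v"
  shows "widely_linked V adj \<beta> L v u"
proof -
  obtain P where P: "disjoint_family_paths V adj \<beta> u v P" "\<forall>i<\<beta>. path_len (P i) \<le> L"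
    using assms(2) by (auto simp: widely_linked_def)
  have "disjoint_family_paths V adj \<beta> v u (\<lambda>i. rev (P i))"
    using P(1) is_path_rev[of adj, OF sym] by (auto simp: disjoint_family_paths_def interior_rev inj_on_def)
  then show ?thesis using P(2) unfolding widely_linked_def
    by (intro exI[of _ "\<lambda>i. rev (P i)"]) (auto simp: path_len_def)
qed

lemma widely_linked_map:
  assumes inj: "inj f" and mem: "\<And>x. x \<in> V \<Longrightarrow> f x \<in> V'"
    and hom: "\<And>x y. adj x y \<Longrightarrow> adj' (f x) (f y)"
    and "widely_linked V adj \<beta> L u v"
  shows "widely_linked V' adj' \<beta> L (f u) (f v)"
proof -
  obtain P where P: "disjoint_family_paths V adj \<beta> u v P" "\<forall>i<\<beta>. path_len (P i) \<le> L"
    using assms(4) by (auto simp: widely_linked_def)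
  have paths: "is_path V' adj' (f u) (f v) (map f p)" if "is_path V adj u v p" for p
    using that mem hom inj
    by (auto simp: is_path_def hd_map last_map distinct_map intro: inj_on_subset)
  have "inj_on (\<lambda>i. map f (P i)) {..<\<beta>}"
    using P(1) inj by (simp add: disjoint_family_paths_def inj_on_def inj_map_eq_map)
  then have "disjoint_family_paths V' adj' \<beta> (f u) (f v) (\<lambda>i. map f (P i))"
    using P(1) paths
    by (simp add: disjoint_family_paths_def interior_map image_Int[OF inj, symmetric])
  then show ?thesis using P(2) unfolding widely_linked_def
    by (intro exI[of _ "\<lambda>i. map f (P i)"]) (auto simp: path_len_def)
qed

text \<open>The start \<open>u\<close> lies outside \<open>insert v S\<close>, so the path from
  \<open>x\<close> cannot return to it and the edge from \<open>u\<close> to \<open>x\<close> can be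
  put in front; \<open>x \<noteq> v\<close> keeps the interior nonempty.\<close>

lemma linkI:
  assumes adjV: "\<And>x y. adj x y \<Longrightarrow> x \<in> V \<and> y \<in> V"
    and "adj u x" "reach adj (insert v S) n x v" "x \<noteq> v" "u \<noteq> v" "u \<notin> S" "v \<notin> S" "Suc n \<le> L"
  shows "link V adj L u v S"
proof -
  obtain p where p: "is_path (insert v S) adj x v p" "path_len p \<le> n"
    using assms(3) by (auto simp: reach_def)
  obtain q where q: "p = q @ [v]"
    using p(1) by (metis append_butlast_last_id is_path_def)
  have qne: "q \<noteq> []" using p(1) assms(4) q by (auto simp: is_path_def)
  have qS: "set q \<subseteq> S" using p(1) q by (auto simp: is_path_def)
  obtain y q' where y: "p = y # q'" using q by (metis append_is_Nil_conv list.exhaust)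
  have path: "is_path (insert u (insert v S)) adj u v (u # p)"
    using p(1) y assms qS q by (auto simp: is_path_Cons_Cons) (auto simp: is_path_def)
  \<comment> \<open>\<open>S\<close> may contain non-vertices, as the supports below leave
    coordinates free over all lists. Every vertex of the path lies on one of its edges, however, and
    edges stay in \<open>V\<close>.\<close>
  have "set (u # p) \<subseteq> V"
  proof
    fix z assume "z \<in> set (u # p)"
    then obtain i where i: "i < length (u # p)" "z = (u # p) ! i" by (metis in_set_conv_nth)
    show "z \<in> V"
    proof (cases i)
      case 0
      then show ?thesis using i adjV assms(2) by auto
    next
      case (Suc j)
      then have "adj ((u # p) ! j) z" using path i unfolding is_path_def by blast
      then show ?thesis using adjV by blast
    qed
  qed
  then have "is_path V adj u v (u # p)" using path by (auto simp: is_path_def)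
  moreover have "interior (u # p) = set q" by (simp add: interior_def q)
  ultimately show ?thesis
    using qne qS p(2) assms(8) q unfolding link_def
    by (intro exI[of _ "u # p"]) (auto simp: path_len_def)
qed

text \<open>A route lists its way points after the start, each with the cost of the leg leading to it.\<close>

fun route :: "('a \<Rightarrow> 'a \<Rightarrow> bool) \<Rightarrow> 'a set \<Rightarrow> 'a \<Rightarrow> (nat \<times> 'a) list \<Rightarrow> 'a \<Rightarrow> bool" where
  "route adj T x [] v \<longleftrightarrow> x = v \<and> v \<in> T"
| "route adj T x ((n, y) # ws) v \<longleftrightarrow> reach adj T n x y \<and> route adj T y ws v"

lemma reach_route: "route adj T x ws v \<Longrightarrow> reach adj T (sum_list (map fst ws)) x v"
  by (induction adj T x ws v rule: route.induct) (auto intro: reach_refl reach_trans)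

lemma link_routeI:
  assumes "\<And>x y. adj x y \<Longrightarrow> x \<in> V \<and> y \<in> V" "adj u x" "route adj (insert v S) x ws v"
    "x \<noteq> v" "u \<noteq> v" "u \<notin> S" "v \<notin> S" "Suc (sum_list (map fst ws)) \<le> L"
  shows "link V adj L u v S"
  using linkI[OF assms(1,2) reach_route[OF assms(3)] assms(4-8)] .

lemma weak_linkI_edge:
  assumes adjV: "\<And>x y. adj x y \<Longrightarrow> x \<in> V \<and> y \<in> V" and "adj u v" "u \<noteq> v" "1 \<le> L"
  shows "weak_link V adj L u v S"
  unfolding weak_link_def using assms
  by (intro exI[of _ "[u, v]"]) (auto simp: is_path_def path_len_def interior_def)

text \<open>Sorts the disjointness checks by type: the families below then need one argument for the
  uniform members \<open>M i\<close> and one for each pair of special members.\<close>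

lemma widely_linked_familyI:
  assumes "k \<ge> 1"
    and Z: "weak_link V adj L u v Z"
    and M: "\<And>i. 0 < i \<Longrightarrow> i < 2 * k \<Longrightarrow> link V adj L u v (M i)"
    and X: "link V adj L u v X" and Y: "link V adj L u v Y"
    and "\<And>i. 0 < i \<Longrightarrow> i < 2 * k \<Longrightarrow> Z \<inter> M i = {}" "Z \<inter> X = {}" "Z \<inter> Y = {}"
    and MM: "\<And>i j. 0 < i \<Longrightarrow> i < j \<Longrightarrow> j < 2 * k \<Longrightarrow> M i \<inter> M j = {}"
    and "\<And>i. 0 < i \<Longrightarrow> i < 2 * k \<Longrightarrow> M i \<inter> X = {}"
    and "\<And>i. 0 < i \<Longrightarrow> i < 2 * k \<Longrightarrow> M i \<inter> Y = {}"
    and "X \<inter> Y = {}"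
  shows "widely_linked V adj (2 * k + 2) L u v"
proof -
  define S where "S i = (if i = 0 then Z else if i < 2 * k then M i else if i = 2 * k then X else Y)" for i
  have strong: "link V adj L u v (S i)" if "0 < i" "i < 2 * k + 2" for i
    using that M X Y by (auto simp: S_def)
  show ?thesis
  proof (rule widely_linkedI[of _ _ _ _ _ _ S])
    show "weak_link V adj L u v (S i)" if "i < 2 * k + 2" for i
      using Z strong[of i] that link_imp_weak_link by (cases "i = 0") (auto simp: S_def)
    show "S i \<inter> S j = {}" if "i < j" "j < 2 * k + 2" for i j
    proof -
      have "j < 2 * k \<or> j = 2 * k \<or> j = Suc (2 * k)" using that by auto
      then show ?thesis using that assms unfolding S_def by (elim disjE) auto
    qed
  qed (use strong in auto)
qed

text \<open>\<open>Min\<close> and \<open>Max\<close> are meaningful only on finite nonempty sets.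
  Path lengths are bounded by \<open>card V\<close>, so only finitely many family lengths occur;
  linkedness makes their set nonempty, and the pair \<open>x0\<close>, \<open>y0\<close> does the
  same for the outer maximum.\<close>

lemma wide_diameter_le:
  assumes fin: "finite V" and "x0 \<in> V" "y0 \<in> V" "x0 \<noteq> y0" "0 < \<beta>"
    and wl: "\<And>u v. u \<in> V \<Longrightarrow> v \<in> V \<Longrightarrow> u \<noteq> v \<Longrightarrow> widely_linked V adj \<beta> L u v"
  shows "wide_diameter V adj \<beta> \<le> L"
proof -
  define F where "F u v = {family_len \<beta> P | P. disjoint_family_paths V adj \<beta> u v P}" for u v
  have fl: "family_len \<beta> P \<le> N" if "\<And>i. i < \<beta> \<Longrightarrow> path_len (P i) \<le> N" for P :: "nat \<Rightarrow> 'a list" and N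
    unfolding family_len_def using that assms(5) by (subst Max_le_iff) auto
  have finF: "finite (F u v)" for u v
  proof (rule finite_subset)
    have "path_len p \<le> card V" if "is_path V adj u v p" for p
      using that fin by (auto simp: is_path_def path_len_def distinct_card[symmetric]
          intro: le_trans[OF diff_le_self] card_mono)
    then show "F u v \<subseteq> {..card V}"
      by (auto simp: F_def disjoint_family_paths_def intro!: fl)
  qed simp
  have "Min (F u v) \<le> L" if "u \<in> V" "v \<in> V" "u \<noteq> v" for u v
  proof -
    have "widely_linked V adj \<beta> L u v" using wl that by blast
    then obtain P where P: "disjoint_family_paths V adj \<beta> u v P" "\<forall>i<\<beta>. path_len (P i) \<le> L"
      by (auto simp: widely_linked_def)
    then have "family_len \<beta> P \<in> F u v" by (auto simp: F_def)
    then have "Min (F u v) \<le> family_len \<beta> P" using finF by simp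
    also have "\<dots> \<le> L" using fl P by blast
    finally show ?thesis .
  qed
  moreover have "finite {Min (F u v) | u v. u \<in> V \<and> v \<in> V \<and> u \<noteq> v}"
    by (rule finite_subset[of _ "(\<lambda>(u, v). Min (F u v)) ` (V \<times> V)"]) (use fin in auto)
  ultimately show ?thesis
    unfolding wide_diameter_def F_def[symmetric] using assms(2-4) by (subst Max_le_iff) auto
qed

section \<open>The Hamming graph of ternary lists\<close>

lemma ternary_0: "ternary 0 x \<longleftrightarrow> x = []"
  by (auto simp: ternary_def)

lemma ternary_Suc_Cons: "ternary (Suc m) (a # x) \<longleftrightarrow> a < 3 \<and> ternary m x"
  by (auto simp: ternary_def)

lemma ternary_SucE:
  assumes "ternary (Suc m) z"
  obtains a x where "z = a # x" "a < 3" "ternary m x"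
  using assms by (cases z) (auto simp: ternary_def)

text \<open>Turns the counting definition into a recursion on the list, on which the inductions on
  the dimension rest.\<close>

lemma differ_in_one_Cons:
  "differ_in_one (a # x) (b # y) \<longleftrightarrow> (a \<noteq> b \<and> x = y) \<or> (a = b \<and> differ_in_one x y)"
proof -
  define D where "D = {i. i < length x \<and> x ! i \<noteq> y ! i}"
  have fin: "finite D" by (simp add: D_def)
  have D': "{i. i < length (a # x) \<and> (a # x) ! i \<noteq> (b # y) ! i}
      = (if a = b then {} else {0}) \<union> Suc ` D"
    (is "?L = ?R")
  proof (rule set_eqI)
    show "i \<in> ?L \<longleftrightarrow> i \<in> ?R" for i by (cases i) (auto simp: D_def)
  qed
  have "card (Suc ` D) = card D" by (simp add: card_image)
  then have card: "card {i. i < length (a # x) \<and> (a # x) ! i \<noteq> (b # y) ! i}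
      = (if a = b then 0 else 1) + card D"
    unfolding D' using fin by (auto simp: card_insert_if)
  have "x = y" if "length x = length y" "card D = 0"
    using that fin by (intro nth_equalityI) (auto simp: D_def)
  moreover have "card D = 0" if "x = y" using that by (simp add: D_def)
  ultimately show ?thesis
    unfolding differ_in_one_def card D_def[symmetric] by auto
qed

lemma differ_in_one_sym: "differ_in_one x y \<Longrightarrow> differ_in_one y x"
  unfolding differ_in_one_def by (simp add: eq_commute)

lemma differ_in_one_irrefl: "\<not> differ_in_one x x"
  by (simp add: differ_in_one_def)

abbreviation hreach :: "nat list set \<Rightarrow> nat \<Rightarrow> nat list \<Rightarrow> nat list \<Rightarrow> bool" where
  "hreach \<equiv> reach differ_in_one"

lemma hreach_Cons:
  assumes "hreach S n x y" "\<And>z. z \<in> S \<Longrightarrow> a # z \<in> T"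
  shows "hreach T n (a # x) (a # y)"
  by (rule reach_map[where f = "(#) a", OF assms(1)]) (simp_all add: differ_in_one_Cons assms(2))

lemma hreach_ternary:
  assumes "ternary m x" "ternary m y"
  shows "hreach {z. ternary m z} m x y"
  using assms
proof (induction m arbitrary: x y)
  case 0
  then show ?case by (auto simp: ternary_0 intro: reach_refl)
next
  case (Suc m)
  obtain a x' where x: "x = a # x'" "a < 3" "ternary m x'" using Suc.prems by (elim ternary_SucE)
  obtain b y' where y: "y = b # y'" "b < 3" "ternary m y'" using Suc.prems by (elim ternary_SucE)
  have 1: "hreach {z. ternary (Suc m) z} m (b # x') y" unfolding y
    by (rule hreach_Cons[OF Suc.IH]) (use x y in \<open>auto simp: ternary_Suc_Cons\<close>)
  show ?case
  proof (cases "a = b")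
    case True
    then show ?thesis using reach_mono[OF 1] x by auto
  next
    case False
    then show ?thesis using reach_Cons[OF _ _ 1, of x] x Suc.prems by (auto simp: differ_in_one_Cons)
  qed
qed

lemma other_digits:
  assumes "(a::nat) < 3"
  obtains e f where "e < 3" "f < 3" "e \<noteq> a" "f \<noteq> a" "e \<noteq> f"
  by (rule that[of "(a + 1) mod 3" "(a + 2) mod 3"]) (use assms in presburger)+

lemma third_digit:
  obtains e where "(e::nat) < 3" "e \<noteq> a" "e \<noteq> b"
  by (rule that[of "if a \<noteq> 0 \<and> b \<noteq> 0 then 0 else if a \<noteq> 1 \<and> b \<noteq> 1 then 1 else 2"]) auto

lemma ternary_neighbours:
  assumes "ternary m x"
  shows "\<exists>c. inj_on c {..<2 * m} \<and> (\<forall>i<2 * m. ternary m (c i) \<and> differ_in_one x (c i))"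
  using assms
proof (induction m arbitrary: x)
  case 0
  then show ?case by simp
next
  case (Suc m)
  obtain a x' where x: "x = a # x'" "a < 3" "ternary m x'" using Suc.prems by (elim ternary_SucE)
  obtain c where c: "inj_on c {..<2 * m}" "\<forall>i<2 * m. ternary m (c i) \<and> differ_in_one x' (c i)"
    using Suc.IH x(3) by blast
  obtain e f where ef: "e < 3" "f < 3" "e \<noteq> a" "f \<noteq> a" "e \<noteq> f" using other_digits x(2) by metis
  define c' where "c' i = (if i < 2 * m then a # c i else if i = 2 * m then e # x' else f # x')" for i
  have "inj_on c' {..<2 * Suc m}"
  proof (rule inj_onI)
    fix i j assume "i \<in> {..<2 * Suc m}" "j \<in> {..<2 * Suc m}" "c' i = c' j"
    then show "i = j" using ef c(1) by (auto simp: c'_def inj_on_def split: if_splits)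
  qed
  moreover have "\<forall>i<2 * Suc m. ternary (Suc m) (c' i) \<and> differ_in_one x (c' i)"
    using c(2) ef x by (auto simp: c'_def ternary_Suc_Cons differ_in_one_Cons)
  ultimately show ?case by blast
qed

text \<open>The Hamming graph has a system of \<open>2 m\<close> internally disjoint paths from \<open>x\<close> to \<open>y\<close>;
  \<open>c i\<close> is the second vertex and \<open>Q i\<close> the interior of path \<open>i\<close>. Path \<open>0\<close> has length at most \<open>m\<close>
  and may be a single edge, which is why \<open>c 0 = y\<close> is allowed.\<close>

definition hfan :: "nat \<Rightarrow> nat list \<Rightarrow> nat list \<Rightarrow> (nat \<Rightarrow> nat list) \<Rightarrow> (nat \<Rightarrow> nat list set) \<Rightarrow> bool" where
  "hfan m x y c Q \<longleftrightarrow>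
     (\<forall>i<2 * m. differ_in_one x (c i) \<and> Q i \<subseteq> {z. ternary m z} \<and> x \<notin> Q i \<and> y \<notin> Q i \<and>
        hreach (insert y (Q i)) (if i = 0 then m - 1 else m) (c i) y \<and> (0 < i \<longrightarrow> c i \<noteq> y)) \<and>
     (\<forall>i<2 * m. \<forall>j<2 * m. i \<noteq> j \<longrightarrow> Q i \<inter> Q j = {})"

text \<open>Splitting off the first digit shows three copies of the smaller graph with equal tails
  joined, so an old path can stay in one copy or cross over to another. Where the tails agree there
  is no smaller fan, and the neighbours of the tail take its place.\<close>

lemma hfan_exists:
  assumes "ternary m x" "ternary m y" "x \<noteq> y"
  shows "\<exists>c Q. hfan m x y c Q"
  using assms
proof (induction m arbitrary: x y)
  case 0
  then show ?case by (simp add: ternary_0)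
next
  case (Suc m)
  obtain a x' where x: "x = a # x'" "a < 3" "ternary m x'" using Suc.prems by (elim ternary_SucE)
  obtain b y' where y: "y = b # y'" "b < 3" "ternary m y'" using Suc.prems by (elim ternary_SucE)
  consider "a = b" "x' \<noteq> y'" | "a \<noteq> b" "x' = y'" | "a \<noteq> b" "x' \<noteq> y'"
    using Suc.prems(3) x y by auto
  then show ?case
  proof cases
    \<comment> \<open>The old paths stay in copy \<open>a\<close>. Each of the two new ones moves to
      another copy, crosses it by the diameter bound and returns at \<open>y\<close>.\<close>
    case 1
    then have m: "0 < m" using x y by (cases m) (auto simp: ternary_0)
    obtain c Q where cQ: "hfan m x' y' c Q" using Suc.IH x y 1 by blast
    obtain e f where ef: "e < 3" "f < 3" "e \<noteq> a" "f \<noteq> a" "e \<noteq> f" using other_digits x(2) by metis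
    define g where "g i = (if i = 2 * m then e else f)" for i
    define c' where "c' i = (if i < 2 * m then a # c i else g i # x')" for i
    define Q' where "Q' i = (if i < 2 * m then (#) a ` Q i else (#) (g i) ` {z. ternary m z})" for i
    have g: "g i < 3" "g i \<noteq> a" for i using ef by (auto simp: g_def)
    have ci: "differ_in_one x' (c i)" "Q i \<subseteq> {z. ternary m z}" "x' \<notin> Q i" "y' \<notin> Q i"
      if "i < 2 * m" for i
      using cQ that by (auto simp: hfan_def)
    have old: "hreach (insert y ((#) a ` Q i)) n (a # c i) y"
      if "hreach (insert y' (Q i)) n (c i) y'" for i n
      unfolding y(1) 1(1)[symmetric] by (rule hreach_Cons[OF that]) auto
    have new: "hreach (insert y ((#) d ` {z. ternary m z})) (Suc m) (d # x') y" if "d \<noteq> a" for d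
      by (rule reach_step[OF hreach_Cons[OF hreach_ternary[OF x(3) y(3)]]])
        (use that x y 1 in \<open>auto simp: differ_in_one_Cons\<close>)
    have "hfan (Suc m) x y c' Q'"
      unfolding hfan_def
    proof (intro conjI allI impI)
      fix i assume i: "i < 2 * Suc m"
      show "differ_in_one x (c' i)" "Q' i \<subseteq> {z. ternary (Suc m) z}" "x \<notin> Q' i" "y \<notin> Q' i"
        using ci[of i] x y 1 g by (auto simp: c'_def Q'_def differ_in_one_Cons ternary_Suc_Cons)
      show "hreach (insert y (Q' i)) (if i = 0 then Suc m - 1 else Suc m) (c' i) y"
      proof (cases "i < 2 * m")
        case True
        then have "hreach (insert y' (Q i)) (if i = 0 then m - 1 else m) (c i) y'"
          using cQ by (auto simp: hfan_def)
        from reach_mono[OF old[OF this] subset_refl, of "if i = 0 then Suc m - 1 else Suc m"] True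
        show ?thesis by (auto simp: c'_def Q'_def)
      next
        case False
        then show ?thesis using new[OF g(2)] m by (auto simp: c'_def Q'_def)
      qed
      show "c' i \<noteq> y" if "0 < i"
        using that cQ i x y 1 g(2)[of i] by (auto simp: hfan_def c'_def)
      show "Q' i \<inter> Q' j = {}" if "j < 2 * Suc m" "i \<noteq> j" for j
      proof -
        have "Q i \<inter> Q j = {}" if "i < 2 * m" "j < 2 * m" using cQ that \<open>i \<noteq> j\<close> by (auto simp: hfan_def)
        moreover have "g i \<noteq> g j" if "\<not> i < 2 * m" "\<not> j < 2 * m"
          using that i \<open>j < 2 * Suc m\<close> \<open>i \<noteq> j\<close> ef by (auto simp: g_def)
        ultimately show ?thesis using g(2)[of i] g(2)[of j] unfolding Q'_def by auto
      qed
    qed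
    then show ?thesis by blast
  next
    \<comment> \<open>One path is the edge itself, one uses the third digit, and each neighbour
      \<open>n\<close> of the tail gives a detour over \<open>a # n\<close> and
      \<open>b # n\<close>. Its existence forces \<open>m \<ge> 1\<close>, so the two steps after
      \<open>a # n\<close> are within the bound.\<close>
    case 2
    obtain n where n: "inj_on n {..<2 * m}" "\<And>i. i < 2 * m \<Longrightarrow> ternary m (n i) \<and> differ_in_one x' (n i)"
      using ternary_neighbours[OF x(3)] by blast
    obtain e where e: "e < 3" "e \<noteq> a" "e \<noteq> b" using third_digit by metis
    define c' where "c' i = (if i = 0 then y else if i = 1 then e # x' else a # n (i - 2))" for i
    define Q' where "Q' i = (if i = 0 then {} else if i = 1 then {e # x'}
        else {a # n (i - 2), b # n (i - 2)})" for i
    have "hfan (Suc m) x y c' Q'"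
      unfolding hfan_def
    proof (intro conjI allI impI)
      fix i assume i: "i < 2 * Suc m"
      have ni: "ternary m (n (i - 2)) \<and> differ_in_one x' (n (i - 2))" if "i \<noteq> 0" "i \<noteq> 1"
        using n(2)[of "i - 2"] i that by auto
      then have nx: "x' \<noteq> n (i - 2)" if "i \<noteq> 0" "i \<noteq> 1" using that differ_in_one_irrefl by metis
      show "differ_in_one x (c' i)" "Q' i \<subseteq> {z. ternary (Suc m) z}" "x \<notin> Q' i" "y \<notin> Q' i"
        using ni nx x y 2 e by (auto simp: c'_def Q'_def differ_in_one_Cons ternary_Suc_Cons)
      show "hreach (insert y (Q' i)) (if i = 0 then Suc m - 1 else Suc m) (c' i) y"
      proof (cases "i = 0 \<or> i = 1")
        case True
        have "hreach {y, e # x'} (Suc 0) (e # x') y"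
          by (rule reach_edge) (use y 2 e in \<open>auto simp: differ_in_one_Cons\<close>)
        from reach_mono[OF this, of _ "Suc m"] True show ?thesis
          by (auto simp: c'_def Q'_def intro: reach_refl)
      next
        case False
        have "m \<ge> 1" using False i by auto
        moreover have "hreach (insert y (Q' i)) (Suc (Suc 0)) (a # n (i - 2)) y"
          by (rule reach_step[OF reach_edge[of _ _ "b # n (i - 2)"]])
            (use False y 2 ni differ_in_one_sym in \<open>auto simp: Q'_def differ_in_one_Cons\<close>)
        ultimately show ?thesis using False reach_mono[of differ_in_one _ "Suc (Suc 0)"]
          by (auto simp: c'_def)
      qed
      show "c' i \<noteq> y" if "0 < i"
        using that y 2 e by (auto simp: c'_def)
      show "Q' i \<inter> Q' j = {}" if j: "j < 2 * Suc m" "i \<noteq> j" for j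
      proof -
        have "n (i - 2) \<noteq> n (j - 2)" if "i > 1" "j > 1"
        proof
          assume "n (i - 2) = n (j - 2)"
          then have "i - 2 = j - 2" using inj_onD[OF n(1)] that i j by auto
          then show False using that j by auto
        qed
        then show ?thesis using e 2 j unfolding Q'_def by auto
      qed
    qed
    then show ?thesis by blast
  next
    \<comment> \<open>Path 0 follows the old path 0 in copy \<open>a\<close> and changes the first
      digit at the end, while path \<open>2 * m\<close> changes it at once and follows the same path
      in copy \<open>b\<close>. The old paths with \<open>0 < i < 2 * m\<close> cross to copy
      \<open>b\<close> right after their first step, and the last path crosses the copy of the third
      digit.\<close>
    case 3
    then have m: "0 < m" using x y by (cases m) (auto simp: ternary_0)
    obtain c Q where cQ: "hfan m x' y' c Q" using Suc.IH x y 3 by blast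
    obtain e where e: "e < 3" "e \<noteq> a" "e \<noteq> b" using third_digit by metis
    define c' where "c' i = (if i < 2 * m then a # c i else if i = 2 * m then b # x' else e # x')" for i
    define Q' where "Q' i = (if i = 0 then (#) a ` insert y' (Q 0)
      else if i < 2 * m then insert (a # c i) ((#) b ` Q i)
      else if i = 2 * m then (#) b ` insert x' (Q 0) else (#) e ` {z. ternary m z})" for i
    have c0: "hreach (insert y' (Q 0)) (m - 1) (c 0) y'" "differ_in_one x' (c 0)"
      "Q 0 \<subseteq> {z. ternary m z}" "x' \<notin> Q 0" "y' \<notin> Q 0"
      using spec[OF conjunct1[OF cQ[unfolded hfan_def]], of 0] m by auto
    have ci: "differ_in_one x' (c i)" "Q i \<subseteq> {z. ternary m z}" "x' \<notin> Q i" "y' \<notin> Q i"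
        "hreach (insert y' (Q i)) m (c i) y'" "c i \<noteq> y'" "c i \<in> Q i" if "0 < i" "i < 2 * m" for i
    proof -
      show h: "differ_in_one x' (c i)" "Q i \<subseteq> {z. ternary m z}" "x' \<notin> Q i" "y' \<notin> Q i"
        "hreach (insert y' (Q i)) m (c i) y'" "c i \<noteq> y'"
        using cQ that by (auto simp: hfan_def)
      then show "c i \<in> Q i" using reach_start by fastforce
    qed
    have "hfan (Suc m) x y c' Q'"
      unfolding hfan_def
    proof (intro conjI allI impI)
      fix i assume i: "i < 2 * Suc m"
      show "differ_in_one x (c' i)"
        using c0 ci x y 3 e by (cases "i = 0") (auto simp: c'_def differ_in_one_Cons)
      show "Q' i \<subseteq> {z. ternary (Suc m) z}" "x \<notin> Q' i" "y \<notin> Q' i"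
        using c0 ci[of i] x y 3 e by (auto simp: Q'_def ternary_Suc_Cons)
      consider "i = 0" | "0 < i" "i < 2 * m" | "i = 2 * m" | "i = Suc (2 * m)"
        using i by (cases "i = 0"; cases "i < 2 * m"; cases "i = 2 * m"; force)
      then show "hreach (insert y (Q' i)) (if i = 0 then Suc m - 1 else Suc m) (c' i) y"
      proof cases
        case 1
        have "hreach (insert y (Q' 0)) (Suc (m - 1)) (a # c 0) y"
          by (rule reach_step[OF hreach_Cons[OF c0(1)]])
            (use y 3 in \<open>auto simp: Q'_def differ_in_one_Cons\<close>)
        then show ?thesis using 1 m by (simp add: c'_def)
      next
        case 2
        have "hreach (insert y (Q' i)) (Suc m) (a # c i) y"
          by (rule reach_Cons[of _ _ "b # c i"], unfold y(1), rule_tac [3] hreach_Cons[OF ci(5)])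
            (use y 3 2 in \<open>auto simp: Q'_def differ_in_one_Cons\<close>)
        then show ?thesis using 2 by (simp add: c'_def)
      next
        case i: 3
        have "hreach (insert y (Q' i)) (Suc (m - 1)) (b # x') y"
          by (rule reach_Cons[of _ _ "b # c 0"], unfold y(1), rule_tac [3] hreach_Cons[OF c0(1)])
            (use y m i c0 in \<open>auto simp: Q'_def differ_in_one_Cons\<close>)
        from reach_mono[OF this subset_refl, of "Suc m"] show ?thesis using i m by (simp add: c'_def)
      next
        case 4
        have "hreach (insert y (Q' i)) (Suc m) (e # x') y"
          by (rule reach_step[OF hreach_Cons[OF hreach_ternary[OF x(3) y(3)]]])
            (use 4 e y in \<open>auto simp: Q'_def differ_in_one_Cons\<close>)
        then show ?thesis using 4 by (simp add: c'_def)
      qed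
      show "c' i \<noteq> y" if "0 < i"
        using that x y 3 e by (auto simp: c'_def)
      have lt: "Q' i \<inter> Q' j = {}" if j: "j < 2 * Suc m" "i < j" for i j
      proof -
        have d: "Q p \<inter> Q q = {}" if "p < 2 * m" "q < 2 * m" "p \<noteq> q" for p q
          using cQ that by (auto simp: hfan_def)
        consider "j < 2 * m" "i = 0" | "j < 2 * m" "0 < i" | "j = 2 * m" | "j = Suc (2 * m)"
          using j by (cases "i = 0"; cases "j < 2 * m"; cases "j = 2 * m"; force)
        then show ?thesis
        proof cases
          case 1
          have "c j \<notin> Q 0" "c j \<noteq> y'" using ci[of j] d[of 0 j] 1 j by auto
          then show ?thesis using d[of 0 j] j 1 3 by (auto simp: Q'_def)
        next
          case 2
          then show ?thesis using d[of i j] ci[of j] ci[of i] j 3 by (auto simp: Q'_def)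
        next
          case 3
          then show ?thesis using d[of 0 i] ci[of i] j \<open>a \<noteq> b\<close> by (auto simp: Q'_def)
        next
          case 4
          then show ?thesis using e j by (auto simp: Q'_def)
        qed
      qed
      show "Q' i \<inter> Q' j = {}" if "j < 2 * Suc m" "i \<noteq> j" for j
        using lt[of j i] lt[of i j] that i by (metis Int_commute linorder_neqE_nat)
    qed
    then show ?thesis by blast
  qed
qed

text \<open>The first \<open>2 * k\<close> paths of a fan, with the consequences that the
  disjointness checks use. Index 0 stands apart because \<open>c 0 = y\<close> is possible only
  there; the last conjunct is the whole path 0, for use as a leg.\<close>

definition hpaths :: "nat \<Rightarrow> nat \<Rightarrow> nat list \<Rightarrow> nat list \<Rightarrow> (nat \<Rightarrow> nat list) \<Rightarrow> (nat \<Rightarrow> nat list set) \<Rightarrow> bool"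
  where
  "hpaths k m x y c Q \<longleftrightarrow>
     (ternary m (c 0) \<and> differ_in_one x (c 0) \<and> c 0 \<noteq> x \<and>
       x \<notin> Q 0 \<and> y \<notin> Q 0 \<and> Q 0 \<subseteq> {z. ternary m z}) \<and>
     hreach (insert y (Q 0)) (m - Suc 0) (c 0) y \<and>
     (\<forall>i. 0 < i \<longrightarrow> i < 2 * k \<longrightarrow> ternary m (c i) \<and> differ_in_one x (c i) \<and> c i \<noteq> x \<and>
       c i \<noteq> y \<and> c i \<in> Q i \<and> c i \<notin> Q 0 \<and> c i \<noteq> c 0 \<and> x \<notin> Q i \<and> y \<notin> Q i \<and>
       Q i \<subseteq> {z. ternary m z} \<and> Q 0 \<inter> Q i = {}) \<and>
     (\<forall>i. 0 < i \<longrightarrow> i < 2 * k \<longrightarrow> hreach (insert y (Q i)) m (c i) y) \<and>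
     (\<forall>i j. 0 < i \<longrightarrow> i < j \<longrightarrow> j < 2 * k \<longrightarrow> c i \<noteq> c j \<and> Q i \<inter> Q j = {}) \<and>
     hreach (insert x (insert y (Q 0))) m x y"

lemma hpathsD:
  assumes "hpaths k m x y c Q"
  shows "ternary m (c 0) \<and> differ_in_one x (c 0) \<and> c 0 \<noteq> x \<and>
       x \<notin> Q 0 \<and> y \<notin> Q 0 \<and> Q 0 \<subseteq> {z. ternary m z}"
    and "hreach (insert y (Q 0)) (m - Suc 0) (c 0) y"
    and "\<And>i. 0 < i \<Longrightarrow> i < 2 * k \<Longrightarrow> ternary m (c i) \<and> differ_in_one x (c i) \<and> c i \<noteq> x \<and>
       c i \<noteq> y \<and> c i \<in> Q i \<and> c i \<notin> Q 0 \<and> c i \<noteq> c 0 \<and> x \<notin> Q i \<and> y \<notin> Q i \<and>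
       Q i \<subseteq> {z. ternary m z} \<and> Q 0 \<inter> Q i = {}"
    and "\<And>i. 0 < i \<Longrightarrow> i < 2 * k \<Longrightarrow> hreach (insert y (Q i)) m (c i) y"
    and "\<And>i j. 0 < i \<Longrightarrow> i < j \<Longrightarrow> j < 2 * k \<Longrightarrow> c i \<noteq> c j \<and> Q i \<inter> Q j = {}"
    and "hreach (insert x (insert y (Q 0))) m x y"
  by (fact assms[unfolded hpaths_def, THEN conjunct1]
      assms[unfolded hpaths_def, THEN conjunct2, THEN conjunct1]
      assms[unfolded hpaths_def, THEN conjunct2, THEN conjunct2, THEN conjunct1, rule_format]
      assms[unfolded hpaths_def, THEN conjunct2, THEN conjunct2, THEN conjunct2, THEN conjunct1, rule_format]
      assms[unfolded hpaths_def, THEN conjunct2, THEN conjunct2, THEN conjunct2, THEN conjunct2, THEN conjunct1, rule_format]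
      assms[unfolded hpaths_def, THEN conjunct2, THEN conjunct2, THEN conjunct2, THEN conjunct2, THEN conjunct2])+

lemma hpaths_exists:
  assumes "ternary m x" "ternary m y" "x \<noteq> y" "k \<le> m" "1 \<le> k"
  obtains c Q where "hpaths k m x y c Q"
proof -
  obtain c Q where cQ: "hfan m x y c Q" using hfan_exists assms by blast
  have A: "differ_in_one x (c i)" "Q i \<subseteq> {z. ternary m z}" "x \<notin> Q i" "y \<notin> Q i"
    "hreach (insert y (Q i)) (if i = 0 then m - 1 else m) (c i) y" "0 < i \<Longrightarrow> c i \<noteq> y"
    "c i \<in> insert y (Q i)" if "i < 2 * k" for i
  proof -
    show h: "differ_in_one x (c i)" "Q i \<subseteq> {z. ternary m z}" "x \<notin> Q i" "y \<notin> Q i"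
      "hreach (insert y (Q i)) (if i = 0 then m - 1 else m) (c i) y" "0 < i \<Longrightarrow> c i \<noteq> y"
      using cQ that assms(4) by (auto simp: hfan_def)
    show "c i \<in> insert y (Q i)" using h(5) by (rule reach_start)
  qed
  have D: "Q i \<inter> Q j = {}" if "i < j" "j < 2 * k" for i j
    using cQ that assms(4) by (auto simp: hfan_def)
  have T: "ternary m (c i)" if "i < 2 * k" for i using A(7,2)[OF that] assms(2) by auto
  have N: "c i \<noteq> x" if "i < 2 * k" for i using A(1)[OF that] differ_in_one_irrefl by metis
  have k: "0 < 2 * k" using assms(5) by simp
  have 1: "ternary m (c 0) \<and> differ_in_one x (c 0) \<and> c 0 \<noteq> x \<and>
       x \<notin> Q 0 \<and> y \<notin> Q 0 \<and> Q 0 \<subseteq> {z. ternary m z}"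
    using A[OF k] T[OF k] N[OF k] by blast
  have 2: "hreach (insert y (Q 0)) (m - Suc 0) (c 0) y" using A(5)[OF k] by simp
  have 3: "ternary m (c i) \<and> differ_in_one x (c i) \<and> c i \<noteq> x \<and>
       c i \<noteq> y \<and> c i \<in> Q i \<and> c i \<notin> Q 0 \<and> c i \<noteq> c 0 \<and> x \<notin> Q i \<and> y \<notin> Q i \<and>
       Q i \<subseteq> {z. ternary m z} \<and> Q 0 \<inter> Q i = {}" if i: "0 < i" "i < 2 * k" for i
    using A(1-4,6,7)[OF i(2)] A(7)[OF k] D[OF i] T[OF i(2)] N[OF i(2)] i(1) by auto
  have 4: "hreach (insert y (Q i)) m (c i) y" if "0 < i" "i < 2 * k" for i
    using A(5)[OF that(2)] that(1) by simp
  have 5: "c i \<noteq> c j \<and> Q i \<inter> Q j = {}" if "0 < i" "i < j" "j < 2 * k" for i j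
    using A(6,7)[of i] A(6,7)[of j] D[of i j] that by auto
  have "hreach (insert x (insert y (Q 0))) (Suc (m - Suc 0)) x y"
    by (rule reach_Cons[OF _ _ reach_mono[OF 2]]) (use A(1)[OF k] in auto)
  then have 6: "hreach (insert x (insert y (Q 0))) m x y" using assms(4,5) by simp
  have "hpaths k m x y c Q"
    unfolding hpaths_def
    by (rule conjI[OF 1 conjI[OF 2 conjI[OF _ conjI[OF _ conjI[OF _ 6]]]]];
        intro allI impI; rule 3 4 5; assumption)
  then show ?thesis using that by blast
qed

text \<open>Takes the place of \<open>hpaths\<close> for a string on which both ends agree: paths
  through these neighbours leave the string and come back to it.\<close>

definition hneighbours :: "nat \<Rightarrow> nat \<Rightarrow> nat list \<Rightarrow> (nat \<Rightarrow> nat list) \<Rightarrow> bool" where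
  "hneighbours k m x c \<longleftrightarrow>
     (\<forall>i<2 * k. ternary m (c i) \<and> differ_in_one x (c i) \<and> c i \<noteq> x) \<and>
     (\<forall>i j. i < j \<longrightarrow> j < 2 * k \<longrightarrow> c i \<noteq> c j)"

lemma hneighboursD:
  assumes "hneighbours k m x c"
  shows "\<And>i. i < 2 * k \<Longrightarrow> ternary m (c i) \<and> differ_in_one x (c i) \<and> c i \<noteq> x"
    and "\<And>i j. i < j \<Longrightarrow> j < 2 * k \<Longrightarrow> c i \<noteq> c j"
  using assms unfolding hneighbours_def by fast+

lemma hneighbours_exists:
  assumes "ternary m x" "k \<le> m"
  obtains c where "hneighbours k m x c"
proof -
  obtain c where c: "inj_on c {..<2 * m}" "\<forall>i<2 * m. ternary m (c i) \<and> differ_in_one x (c i)"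
    using ternary_neighbours[OF assms(1)] by blast
  have "ternary m (c i) \<and> differ_in_one x (c i) \<and> c i \<noteq> x" if "i < 2 * k" for i
    using c(2) that assms(2) differ_in_one_irrefl by (metis less_le_trans mult_le_mono2)
  moreover have "c i \<noteq> c j" if "i < j" "j < 2 * k" for i j
    using inj_onD[OF c(1), of i j] that assms(2) by auto
  ultimately have "hneighbours k m x c" by (simp add: hneighbours_def)
  then show ?thesis using that by blast
qed

section \<open>Legs in the exchanged cube\<close>

lemma E3C_adj_vertices: "E3C_adj r s t x y \<Longrightarrow> x \<in> E3C_vertices r s t \<and> y \<in> E3C_vertices r s t"
  by (simp add: E3C_adj_def)

lemma E3C_adj_sym: "E3C_adj r s t x y \<Longrightarrow> E3C_adj r s t y x"
  by (auto simp: E3C_adj_def intro: differ_in_one_sym)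

lemma E3C_adj_iff:
  "E3C_adj r s t (a, b, c, d) (a', b', c', d') \<longleftrightarrow>
     ternary r a \<and> ternary s b \<and> ternary t c \<and> d < 3 \<and>
     ternary r a' \<and> ternary s b' \<and> ternary t c' \<and> d' < 3 \<and>
     (a = a' \<and> b = b' \<and> c = c' \<and> d \<noteq> d'
      \<or> d = 0 \<and> d' = 0 \<and> a = a' \<and> b = b' \<and> differ_in_one c c'
      \<or> d = 1 \<and> d' = 1 \<and> a = a' \<and> c = c' \<and> differ_in_one b b'
      \<or> d = 2 \<and> d' = 2 \<and> b = b' \<and> c = c' \<and> differ_in_one a a')"
  by (auto simp: E3C_adj_def E3C_vertices_def differ_in_one_irrefl)

text \<open>Fixing the layer and the two strings that it does not move embeds a Hamming graph in the
  cube, so disjoint Hamming paths turn into disjoint legs.\<close>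

lemma leg0:
  assumes "hreach Q n c c'" "ternary r a" "ternary s b"
    and "\<And>z. z \<in> Q \<Longrightarrow> ternary t z" "\<And>z. z \<in> Q \<Longrightarrow> (a, b, z, 0) \<in> T"
  shows "reach (E3C_adj r s t) T n (a, b, c, 0) (a, b, c', 0)"
  by (rule reach_map[where f = "\<lambda>z. (a, b, z, 0)", OF assms(1)]) (simp_all add: E3C_adj_iff assms)

lemma leg1:
  assumes "hreach Q n b b'" "ternary r a" "ternary t c"
    and "\<And>z. z \<in> Q \<Longrightarrow> ternary s z" "\<And>z. z \<in> Q \<Longrightarrow> (a, z, c, Suc 0) \<in> T"
  shows "reach (E3C_adj r s t) T n (a, b, c, Suc 0) (a, b', c, Suc 0)"
  by (rule reach_map[where f = "\<lambda>z. (a, z, c, Suc 0)", OF assms(1)]) (simp_all add: E3C_adj_iff assms)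

lemma leg2:
  assumes "hreach Q n a a'" "ternary s b" "ternary t c"
    and "\<And>z. z \<in> Q \<Longrightarrow> ternary r z" "\<And>z. z \<in> Q \<Longrightarrow> (z, b, c, 2) \<in> T"
  shows "reach (E3C_adj r s t) T n (a, b, c, 2) (a', b, c, 2)"
  by (rule reach_map[where f = "\<lambda>z. (z, b, c, 2)", OF assms(1)]) (simp_all add: E3C_adj_iff assms)

lemma line0:
  assumes "ternary r a" "ternary s b" "ternary t c" "ternary t c'" "\<And>z. (a, b, z, 0) \<in> T"
  shows "reach (E3C_adj r s t) T t (a, b, c, 0) (a, b, c', 0)"
  using assms by (intro leg0[OF hreach_ternary]) auto

lemma line1:
  assumes "ternary r a" "ternary s b" "ternary t c" "ternary s b'" "\<And>z. (a, z, c, Suc 0) \<in> T"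
  shows "reach (E3C_adj r s t) T s (a, b, c, Suc 0) (a, b', c, Suc 0)"
  using assms by (intro leg1[OF hreach_ternary]) auto

lemma line2:
  assumes "ternary r a" "ternary s b" "ternary t c" "ternary r a'" "\<And>z. (z, b, c, 2) \<in> T"
  shows "reach (E3C_adj r s t) T r (a, b, c, 2) (a', b, c, 2)"
  using assms by (intro leg2[OF hreach_ternary]) auto

lemma edge0:
  assumes "ternary r a" "ternary s b" "ternary t c" "ternary t c'" "differ_in_one c c'"
    "(a, b, c, 0) \<in> T" "(a, b, c', 0) \<in> T"
  shows "reach (E3C_adj r s t) T (Suc 0) (a, b, c, 0) (a, b, c', 0)"
  using assms by (intro reach_edge) (auto simp: E3C_adj_iff)

lemma edge1:
  assumes "ternary r a" "ternary s b" "ternary t c" "ternary s b'" "differ_in_one b b'"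
    "(a, b, c, Suc 0) \<in> T" "(a, b', c, Suc 0) \<in> T"
  shows "reach (E3C_adj r s t) T (Suc 0) (a, b, c, Suc 0) (a, b', c, Suc 0)"
  using assms by (intro reach_edge) (auto simp: E3C_adj_iff)

lemma edge2:
  assumes "ternary r a" "ternary s b" "ternary t c" "ternary r a'" "differ_in_one a a'"
    "(a, b, c, 2) \<in> T" "(a', b, c, 2) \<in> T"
  shows "reach (E3C_adj r s t) T (Suc 0) (a, b, c, 2) (a', b, c, 2)"
  using assms by (intro reach_edge) (auto simp: E3C_adj_iff)

lemma switch:
  assumes "ternary r a" "ternary s b" "ternary t c" "(a, b, c, d) \<in> T" "(a, b, c, d') \<in> T"
    "d < 3" "d' < 3" "d \<noteq> d'"
  shows "reach (E3C_adj r s t) T (Suc 0) (a, b, c, d) (a, b, c, d')"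
  using assms by (intro reach_edge) (auto simp: E3C_adj_iff)

text \<open>Stated with literal layers, so that a leg inside a layer cannot be mistaken for a switch.\<close>

lemmas switches =
  switch[where d = 0 and d' = "Suc 0"] switch[where d = 0 and d' = 2]
  switch[where d = "Suc 0" and d' = 0] switch[where d = "Suc 0" and d' = 2]
  switch[where d = 2 and d' = 0] switch[where d = 2 and d' = "Suc 0"]

lemmas legs = switches edge0 edge1 edge2 line0 line1 line2

text \<open>Omits \<open>line0\<close>, which would take a leg of cost \<open>t\<close> in layer 0
  for a full line; in the families that use this collection the final leg must stay within one path
  of the fan.\<close>

lemmas partial_legs = switches edge0 edge1 edge2 line1 line2

lemmas E3C_linkI = link_routeI[where adj = "E3C_adj r s t" and V = "E3C_vertices r s t" for r s t,
    OF E3C_adj_vertices]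

abbreviation E3C_wide :: "nat \<Rightarrow> nat \<Rightarrow> nat \<Rightarrow> nat \<Rightarrow> e3c_vertex \<Rightarrow> e3c_vertex \<Rightarrow> bool" where
  "E3C_wide k r s t \<equiv>
     widely_linked (E3C_vertices r s t) (E3C_adj r s t) (2 * k + 2) (r + s + t + 6)"

text \<open>The bounds are stated for every \<open>k\<close> below \<open>r\<close>, \<open>s\<close> and \<open>t\<close>, rather than for ordered
  parameters, to make them invariant under exchanging layers.\<close>

locale e3c =
  fixes r s t k :: nat
  assumes k: "1 \<le> k" "k \<le> r" "k \<le> s" "k \<le> t"
begin

abbreviation lnk :: "e3c_vertex \<Rightarrow> e3c_vertex \<Rightarrow> e3c_vertex set \<Rightarrow> bool" where
  "lnk \<equiv> link (E3C_vertices r s t) (E3C_adj r s t) (r + s + t + 6)"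

abbreviation wide :: "e3c_vertex \<Rightarrow> e3c_vertex \<Rightarrow> bool" where
  "wide \<equiv> E3C_wide k r s t"

lemma pos: "1 \<le> r" "1 \<le> s" "1 \<le> t" "0 < 2 * k"
  using k by auto

section \<open>Disjoint paths between given layers\<close>

text \<open>Except when \<open>Z\<close> is a single edge, \<open>Z\<close> and the sets \<open>M i\<close> support the paths that leave the first
  vertex inside its own layer, through the neighbours \<open>c i\<close> of \<open>C\<close>, and \<open>X\<close>, \<open>Y\<close> those that leave it by a switch. A path
  supported by \<open>M i\<close> keeps the last string equal to \<open>c i\<close> while it changes the other two, so distinct
  neighbours keep these paths apart. If \<open>C \<noteq> C'\<close>, the path through \<open>Z\<close> instead follows the distinguished path from
  \<open>C\<close> to \<open>C'\<close>, because \<open>c 0\<close> may equal \<open>C'\<close>. A coordinate that is left free stands for a whole line.\<close>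

lemma wide01_all_differ:
  assumes T: "ternary r A" "ternary r A'" "ternary s B" "ternary s B'" "ternary t C" "ternary t C'"
    and N: "A \<noteq> A'" "B \<noteq> B'" "C \<noteq> C'"
  shows "wide (A, B, C, 0) (A', B', C', 1)"
proof -
  obtain c Q where "hpaths k t C C' c Q"
    using hpaths_exists[OF T(5) T(6) N(3) k(4) k(1)] .
  note c = hpathsD[OF this]
  \<comment> \<open>The fan starts from \<open>B'\<close>, because the \<open>b i\<close> have to be
    neighbours of the end; \<open>b'\<close> runs its path 0 backwards.\<close>
  obtain b R where "hpaths k s B' B b R"
    using hpaths_exists[OF T(4) T(3) N(2)[symmetric] k(3) k(1)] .
  note b = hpathsD[OF this]
  note b' = reach_sym[OF differ_in_one_sym b(6)]
  \<comment> \<open>The last leg keeps to \<open>R 0\<close>, since the vertices of layer 1 with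
    strings \<open>A'\<close>, \<open>b i\<close>, \<open>C'\<close> belong to
    \<open>?M i\<close>.\<close>
  let ?Z = "{(x, y, z, d). d = 0 \<and> x = A \<and> y = B \<and> z \<in> insert C' (Q 0)
      \<or> d = 2 \<and> y = B \<and> z = C'
      \<or> d = 1 \<and> x = A' \<and> y \<in> insert B (R 0) \<and> z = C'} :: e3c_vertex set"
  \<comment> \<open>Once the third string changes to \<open>C'\<close>, \<open>c i\<close> no longer
    separates these paths and the second string \<open>b i\<close> takes over. The exchange happens
    in layer 1, on the line with \<open>A'\<close> and \<open>c i\<close>.\<close>
  let ?M = "\<lambda>i. {(x, y, z, d). d = 0 \<and> x = A \<and> y = B \<and> z = c i
      \<or> d = 2 \<and> y = B \<and> z = c i \<or> d = 1 \<and> x = A' \<and> z = c i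
      \<or> d = 0 \<and> x = A' \<and> y = b i
      \<or> d = 1 \<and> x = A' \<and> y = b i \<and> z = C'} :: e3c_vertex set"
  \<comment> \<open>\<open>?Z\<close> and the \<open>?M i\<close> enter the end inside layer 1,
    which leaves the switches from layers 0 and 2 to \<open>?X\<close> and
    \<open>?Y\<close>.\<close>
  let ?X = "{(x, y, z, d). d = 2 \<and> y = B \<and> z = C \<or> d = 1 \<and> x = A' \<and> z = C
      \<or> d = 0 \<and> x = A' \<and> y = B'} :: e3c_vertex set"
  let ?Y = "{(x, y, z, d). d = 1 \<and> x = A \<and> z = C \<or> d = 0 \<and> x = A \<and> y = B'
      \<or> d = 2 \<and> y = B' \<and> z = C'} :: e3c_vertex set"
  show ?thesis
  proof (rule widely_linked_familyI[where Z = ?Z and M = ?M and X = ?X and Y = ?Y, OF k(1)])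
    show "weak_link (E3C_vertices r s t) (E3C_adj r s t) (r + s + t + 6) (A, B, C, 0) (A', B', C', 1) ?Z"
      by (rule link_imp_weak_link, rule E3C_linkI[where x = "(A, B, c 0, 0)" and
          ws = "[(t - Suc 0, (A, B, C', 0)), (1, (A, B, C', 2)), (r, (A', B, C', 2)),
          (1, (A', B, C', 1)), (s, (A', B', C', 1))]"])
        (use T N c(1) b(1) pos in
          \<open>auto simp: E3C_adj_iff intro!: leg0[OF c(2)] leg1[OF b'] switches line2\<close>)
    show "lnk (A, B, C, 0) (A', B', C', 1) (?M i)" if "0 < i" "i < 2 * k" for i
      by (rule E3C_linkI[where x = "(A, B, c i, 0)" and
          ws = "[(1, (A, B, c i, 2)), (r, (A', B, c i, 2)), (1, (A', B, c i, 1)),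
          (s, (A', b i, c i, 1)), (1, (A', b i, c i, 0)), (t, (A', b i, C', 0)),
          (1, (A', b i, C', 1)), (1, (A', B', C', 1))]"])
        (use T N c(3)[OF that] b(3)[OF that] differ_in_one_sym in
          \<open>auto simp: E3C_adj_iff intro!: legs\<close>)
    show "lnk (A, B, C, 0) (A', B', C', 1) ?X"
      by (rule E3C_linkI[where x = "(A, B, C, 2)" and
          ws = "[(r, (A', B, C, 2)), (1, (A', B, C, 1)), (s, (A', B', C, 1)), (1, (A', B', C, 0)),
          (t, (A', B', C', 0)), (1, (A', B', C', 1))]"])
        (use T N in
          \<open>auto simp: E3C_adj_iff intro!: legs\<close>)
    show "lnk (A, B, C, 0) (A', B', C', 1) ?Y"
      by (rule E3C_linkI[where x = "(A, B, C, 1)" and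
          ws = "[(s, (A, B', C, 1)), (1, (A, B', C, 0)), (t, (A, B', C', 0)), (1, (A, B', C', 2)),
          (r, (A', B', C', 2)), (1, (A', B', C', 1))]"])
        (use T N in
          \<open>auto simp: E3C_adj_iff intro!: legs\<close>)
    show "?Z \<inter> ?M i = {}" "?M i \<inter> ?X = {}" "?M i \<inter> ?Y = {}" if "0 < i" "i < 2 * k" for i
      using N c(3)[OF that] b(3)[OF that] by auto
    show "?Z \<inter> ?X = {}" "?Z \<inter> ?Y = {}" "?X \<inter> ?Y = {}"
      using N c(1) b(1) by auto
    show "?M i \<inter> ?M j = {}" if "0 < i" "i < j" "j < 2 * k" for i j
      using N c(3)[of i] b(3)[of i] c(3)[of j] b(3)[of j] c(5)[OF that] b(5)[OF that] that by auto
  qed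
qed

text \<open>From \<open>(A, B, C, 2)\<close> a switch leads only to the start or to the first vertex
  of \<open>?Y\<close>. So \<open>?X\<close> steps aside to \<open>a 0\<close> in layer 2 and
  returns to \<open>A\<close> there just before the end.\<close>

lemma wide01_A_eq:
  assumes T: "ternary r A" "ternary s B" "ternary s B'" "ternary t C" "ternary t C'"
    and N: "B \<noteq> B'" "C \<noteq> C'"
  shows "wide (A, B, C, 0) (A, B', C', 1)"
proof -
  obtain c Q where "hpaths k t C C' c Q"
    using hpaths_exists[OF T(4) T(5) N(2) k(4) k(1)] .
  note c = hpathsD[OF this]
  obtain b R where "hpaths k s B' B b R"
    using hpaths_exists[OF T(3) T(2) N(1)[symmetric] k(3) k(1)] .
  note b = hpathsD[OF this]
  note b' = reach_sym[OF differ_in_one_sym b(6)]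
  obtain a where "hneighbours k r A a" using hneighbours_exists[OF T(1) k(2)] .
  note a = hneighboursD[OF this]
  note a = a(1)[OF pos(4)]
  let ?Z = "{(x, y, z, d). d = 0 \<and> x = A \<and> y = B \<and> z \<in> insert C' (Q 0)
      \<or> d = 1 \<and> x = A \<and> y \<in> insert B (R 0) \<and> z = C'} :: e3c_vertex set"
  let ?M = "\<lambda>i. {(x, y, z, d). d = 0 \<and> x = A \<and> y = B \<and> z = c i
      \<or> d = 1 \<and> x = A \<and> z = c i \<or> d = 0 \<and> x = A \<and> y = b i
      \<or> d = 1 \<and> x = A \<and> y = b i \<and> z = C'} :: e3c_vertex set"
  let ?X = "{(x, y, z, d). d = 2 \<and> y = B \<and> z = C \<or> d = 1 \<and> x = a 0 \<and> z = C
      \<or> d = 0 \<and> x = a 0 \<and> y = B'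
      \<or> d = 2 \<and> y = B' \<and> z = C'} :: e3c_vertex set"
  let ?Y = "{(x, y, z, d). d = 1 \<and> x = A \<and> z = C
      \<or> d = 0 \<and> x = A \<and> y = B'} :: e3c_vertex set"
  show ?thesis
  proof (rule widely_linked_familyI[where Z = ?Z and M = ?M and X = ?X and Y = ?Y, OF k(1)])
    show "weak_link (E3C_vertices r s t) (E3C_adj r s t) (r + s + t + 6) (A, B, C, 0) (A, B', C', 1) ?Z"
      by (rule link_imp_weak_link, rule E3C_linkI[where x = "(A, B, c 0, 0)" and
          ws = "[(t - Suc 0, (A, B, C', 0)), (1, (A, B, C', 1)), (s, (A, B', C', 1))]"])
        (use T N c(1) b(1) pos in
          \<open>auto simp: E3C_adj_iff intro!: leg0[OF c(2)] leg1[OF b'] switches line2\<close>)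
    show "lnk (A, B, C, 0) (A, B', C', 1) (?M i)" if "0 < i" "i < 2 * k" for i
      by (rule E3C_linkI[where x = "(A, B, c i, 0)" and
          ws = "[(1, (A, B, c i, 1)), (s, (A, b i, c i, 1)), (1, (A, b i, c i, 0)),
          (t, (A, b i, C', 0)), (1, (A, b i, C', 1)), (1, (A, B', C', 1))]"])
        (use T N c(3)[OF that] b(3)[OF that] differ_in_one_sym in
          \<open>auto simp: E3C_adj_iff intro!: legs\<close>)
    \<comment> \<open>Seven steps besides \<open>s + t\<close>; the bound holds because
      \<open>r \<ge> 1\<close>.\<close>
    show "lnk (A, B, C, 0) (A, B', C', 1) ?X"
      by (rule E3C_linkI[where x = "(A, B, C, 2)" and
          ws = "[(1, (a 0, B, C, 2)), (1, (a 0, B, C, 1)), (s, (a 0, B', C, 1)),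
          (1, (a 0, B', C, 0)), (t, (a 0, B', C', 0)), (1, (a 0, B', C', 2)),
          (1, (A, B', C', 2)), (1, (A, B', C', 1))]"])
        (use T N a pos differ_in_one_sym in
          \<open>auto simp: E3C_adj_iff intro!: legs\<close>)
    show "lnk (A, B, C, 0) (A, B', C', 1) ?Y"
      by (rule E3C_linkI[where x = "(A, B, C, 1)" and
          ws = "[(s, (A, B', C, 1)), (1, (A, B', C, 0)), (t, (A, B', C', 0)), (1, (A, B', C', 1))]"])
        (use T N in
          \<open>auto simp: E3C_adj_iff intro!: legs\<close>)
    show "?Z \<inter> ?M i = {}" "?M i \<inter> ?X = {}" "?M i \<inter> ?Y = {}" if "0 < i" "i < 2 * k" for i
      using N a c(3)[OF that] b(3)[OF that] by auto
    show "?Z \<inter> ?X = {}" "?Z \<inter> ?Y = {}" "?X \<inter> ?Y = {}"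
      using N a c(1) b(1) by auto
    show "?M i \<inter> ?M j = {}" if "0 < i" "i < j" "j < 2 * k" for i j
      using N c(3)[of i] b(3)[of i] c(3)[of j] b(3)[of j] c(5)[OF that] b(5)[OF that] that by auto
  qed
qed

text \<open>From \<open>(A, B, C, 1)\<close> a switch leads only to the start or to the first vertex
  of \<open>?X\<close>, so \<open>?Y\<close> must move to a neighbour \<open>b 0\<close> of
  \<open>B\<close>. It keeps \<open>b 0\<close> until its last step inside layer 1, and
  \<open>?Z\<close> enters the end by the switch from layer 2 instead.\<close>

lemma wide01_B_eq:
  assumes T: "ternary r A" "ternary r A'" "ternary s B" "ternary t C" "ternary t C'"
    and N: "A \<noteq> A'" "C \<noteq> C'"
  shows "wide (A, B, C, 0) (A', B, C', 1)"
proof -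
  obtain c Q where "hpaths k t C C' c Q"
    using hpaths_exists[OF T(4) T(5) N(2) k(4) k(1)] .
  note c = hpathsD[OF this]
  obtain b where "hneighbours k s B b" using hneighbours_exists[OF T(3) k(3)] .
  note b = hneighboursD[OF this]
  let ?Z = "{(x, y, z, d). d = 0 \<and> x = A \<and> y = B \<and> z \<in> insert C' (Q 0)
      \<or> d = 2 \<and> y = B \<and> z = C'} :: e3c_vertex set"
  let ?M = "\<lambda>i. {(x, y, z, d). d = 0 \<and> x = A \<and> y = B \<and> z = c i
      \<or> d = 2 \<and> y = B \<and> z = c i \<or> d = 1 \<and> x = A' \<and> z = c i
      \<or> d = 0 \<and> x = A' \<and> y = b i
      \<or> d = 1 \<and> x = A' \<and> y = b i \<and> z = C'} :: e3c_vertex set"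
  let ?X = "{(x, y, z, d). d = 2 \<and> y = B \<and> z = C
      \<or> d = 0 \<and> x = A' \<and> y = B} :: e3c_vertex set"
  let ?Y = "{(x, y, z, d). d = 1 \<and> x = A \<and> z = C \<or> d = 0 \<and> x = A \<and> y = b 0
      \<or> d = 2 \<and> y = b 0 \<and> z = C'
      \<or> d = 1 \<and> x = A' \<and> y = b 0 \<and> z = C'} :: e3c_vertex set"
  show ?thesis
  proof (rule widely_linked_familyI[where Z = ?Z and M = ?M and X = ?X and Y = ?Y, OF k(1)])
    show "weak_link (E3C_vertices r s t) (E3C_adj r s t) (r + s + t + 6) (A, B, C, 0) (A', B, C', 1) ?Z"
      by (rule link_imp_weak_link, rule E3C_linkI[where x = "(A, B, c 0, 0)" and
          ws = "[(t - Suc 0, (A, B, C', 0)), (1, (A, B, C', 2)), (r, (A', B, C', 2)),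
          (1, (A', B, C', 1))]"])
        (use T N c(1) pos in
          \<open>auto simp: E3C_adj_iff intro!: leg0[OF c(2)] legs\<close>)
    show "lnk (A, B, C, 0) (A', B, C', 1) (?M i)" if "0 < i" "i < 2 * k" for i
      by (rule E3C_linkI[where x = "(A, B, c i, 0)" and
          ws = "[(1, (A, B, c i, 2)), (r, (A', B, c i, 2)), (1, (A', B, c i, 1)),
          (s, (A', b i, c i, 1)), (1, (A', b i, c i, 0)), (t, (A', b i, C', 0)),
          (1, (A', b i, C', 1)), (1, (A', B, C', 1))]"])
        (use T N c(3)[OF that] b(1)[OF that(2)] differ_in_one_sym in
          \<open>auto simp: E3C_adj_iff intro!: legs\<close>)
    show "lnk (A, B, C, 0) (A', B, C', 1) ?X"
      by (rule E3C_linkI[where x = "(A, B, C, 2)" and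
          ws = "[(r, (A', B, C, 2)), (1, (A', B, C, 0)), (t, (A', B, C', 0)), (1, (A', B, C', 1))]"])
        (use T N in
          \<open>auto simp: E3C_adj_iff intro!: legs\<close>)
    show "lnk (A, B, C, 0) (A', B, C', 1) ?Y"
      by (rule E3C_linkI[where x = "(A, B, C, 1)" and
          ws = "[(1, (A, b 0, C, 1)), (1, (A, b 0, C, 0)), (t, (A, b 0, C', 0)),
          (1, (A, b 0, C', 2)), (r, (A', b 0, C', 2)), (1, (A', b 0, C', 1)),
          (1, (A', B, C', 1))]"])
        (use T N b(1)[OF pos(4)] pos differ_in_one_sym in
          \<open>auto simp: E3C_adj_iff intro!: legs\<close>)
    show "?Z \<inter> ?M i = {}" "?M i \<inter> ?X = {}" "?M i \<inter> ?Y = {}" if "0 < i" "i < 2 * k" for i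
      using N c(3)[OF that] b(1)[OF that(2)] b(1)[OF pos(4)] b(2)[OF that] by auto
    show "?Z \<inter> ?X = {}" "?Z \<inter> ?Y = {}" "?X \<inter> ?Y = {}"
      using N c(1) b(1)[OF pos(4)] by auto
    show "?M i \<inter> ?M j = {}" if "0 < i" "i < j" "j < 2 * k" for i j
      using N c(3)[of i] b(1)[of i] c(3)[of j] b(1)[of j] c(5)[OF that] b(2)[OF that(2,3)] that by auto
  qed
qed

text \<open>Only \<open>A\<close> has to change, which only layer 2 can do. The paths cross it on
  parallel lines: at \<open>(B, C)\<close> for \<open>?X\<close>, at \<open>(b 0, C)\<close> for
  \<open>?Y\<close>, and at \<open>(B, c i)\<close> for \<open>?Z\<close> and the
  \<open>?M i\<close>.\<close>

lemma wide01_B_C_eq: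
  assumes T: "ternary r A" "ternary r A'" "ternary s B" "ternary t C"
    and N: "A \<noteq> A'"
  shows "wide (A, B, C, 0) (A', B, C, 1)"
proof -
  obtain c where "hneighbours k t C c" using hneighbours_exists[OF T(4) k(4)] .
  note c = hneighboursD[OF this]
  obtain b where "hneighbours k s B b" using hneighbours_exists[OF T(3) k(3)] .
  note b = hneighboursD[OF this]
  note c0 = c(1)[OF pos(4)] and b0 = b(1)[OF pos(4)]
  let ?Z = "{(x, y, z, d). d = 0 \<and> x = A \<and> y = B \<and> z = c 0
      \<or> d = 2 \<and> y = B \<and> z = c 0
      \<or> d = 0 \<and> x = A' \<and> y = B} :: e3c_vertex set"
  let ?M = "\<lambda>i. {(x, y, z, d). d = 0 \<and> x = A \<and> y = B \<and> z = c i
      \<or> d = 2 \<and> y = B \<and> z = c i \<or> d = 1 \<and> x = A' \<and> z = c i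
      \<or> d = 0 \<and> x = A' \<and> y = b i
      \<or> d = 1 \<and> x = A' \<and> y = b i \<and> z = C} :: e3c_vertex set"
  let ?X = "{(x, y, z, d). d = 2 \<and> y = B \<and> z = C} :: e3c_vertex set"
  let ?Y = "{(x, y, z, d). d = 1 \<and> x = A \<and> z = C \<or> d = 2 \<and> y = b 0 \<and> z = C
      \<or> d = 1 \<and> x = A' \<and> y = b 0 \<and> z = C} :: e3c_vertex set"
  show ?thesis
  proof (rule widely_linked_familyI[where Z = ?Z and M = ?M and X = ?X and Y = ?Y, OF k(1)])
    show "weak_link (E3C_vertices r s t) (E3C_adj r s t) (r + s + t + 6) (A, B, C, 0) (A', B, C, 1) ?Z"
      by (rule link_imp_weak_link, rule E3C_linkI[where x = "(A, B, c 0, 0)" and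
          ws = "[(1, (A, B, c 0, 2)), (r, (A', B, c 0, 2)), (1, (A', B, c 0, 0)),
          (t, (A', B, C, 0)), (1, (A', B, C, 1))]"])
        (use T N c0 pos in
          \<open>auto simp: E3C_adj_iff intro!: legs\<close>)
    show "lnk (A, B, C, 0) (A', B, C, 1) (?M i)" if "0 < i" "i < 2 * k" for i
      by (rule E3C_linkI[where x = "(A, B, c i, 0)" and
          ws = "[(1, (A, B, c i, 2)), (r, (A', B, c i, 2)), (1, (A', B, c i, 1)),
          (s, (A', b i, c i, 1)), (1, (A', b i, c i, 0)), (t, (A', b i, C, 0)),
          (1, (A', b i, C, 1)), (1, (A', B, C, 1))]"])
        (use T N c(1)[OF that(2)] b(1)[OF that(2)] differ_in_one_sym in
          \<open>auto simp: E3C_adj_iff intro!: legs\<close>)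
    show "lnk (A, B, C, 0) (A', B, C, 1) ?X"
      by (rule E3C_linkI[where x = "(A, B, C, 2)" and
          ws = "[(r, (A', B, C, 2)), (1, (A', B, C, 1))]"])
        (use T N in
          \<open>auto simp: E3C_adj_iff intro!: legs\<close>)
    show "lnk (A, B, C, 0) (A', B, C, 1) ?Y"
      by (rule E3C_linkI[where x = "(A, B, C, 1)" and
          ws = "[(1, (A, b 0, C, 1)), (1, (A, b 0, C, 2)), (r, (A', b 0, C, 2)),
          (1, (A', b 0, C, 1)), (1, (A', B, C, 1))]"])
        (use T N b0 pos differ_in_one_sym in
          \<open>auto simp: E3C_adj_iff intro!: legs\<close>)
    show "?Z \<inter> ?M i = {}" "?M i \<inter> ?X = {}" "?M i \<inter> ?Y = {}" if "0 < i" "i < 2 * k" for i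
      using N c(1)[OF that(2)] b(1)[OF that(2)] c0 b0 c(2)[OF that] b(2)[OF that] by auto
    show "?Z \<inter> ?X = {}" "?Z \<inter> ?Y = {}" "?X \<inter> ?Y = {}"
      using N c0 b0 by auto
    show "?M i \<inter> ?M j = {}" if "0 < i" "i < j" "j < 2 * k" for i j
      using N c(1)[of i] b(1)[of i] c(1)[of j] b(1)[of j] c(2)[OF that(2,3)] b(2)[OF that(2,3)] that by auto
  qed
qed

text \<open>Only \<open>C\<close> has to change, which only layer 0 can do. The crossings lie on the
  line at \<open>(A, B)\<close> for \<open>?Z\<close>, at \<open>(A, b i)\<close> for the
  \<open>?M i\<close>, at \<open>(A, b 0)\<close> for \<open>?Y\<close> and at
  \<open>(a 0, B)\<close> for \<open>?X\<close>.\<close>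

lemma wide01_A_B_eq:
  assumes T: "ternary r A" "ternary s B" "ternary t C" "ternary t C'"
    and N: "C \<noteq> C'"
  shows "wide (A, B, C, 0) (A, B, C', 1)"
proof -
  obtain c Q where "hpaths k t C C' c Q"
    using hpaths_exists[OF T(3) T(4) N k(4) k(1)] .
  note c = hpathsD[OF this]
  obtain b where "hneighbours k s B b" using hneighbours_exists[OF T(2) k(3)] .
  note b = hneighboursD[OF this]
  obtain a where "hneighbours k r A a" using hneighbours_exists[OF T(1) k(2)] .
  note a = hneighboursD[OF this]
  note b0 = b(1)[OF pos(4)] and a = a(1)[OF pos(4)]
  let ?Z = "{(x, y, z, d). d = 0 \<and> x = A \<and> y = B \<and> z \<in> insert C' (Q 0)} :: e3c_vertex set"
  let ?M = "\<lambda>i. {(x, y, z, d). d = 0 \<and> x = A \<and> y = B \<and> z = c i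
      \<or> d = 1 \<and> x = A \<and> z = c i \<or> d = 0 \<and> x = A \<and> y = b i
      \<or> d = 1 \<and> x = A \<and> y = b i \<and> z = C'} :: e3c_vertex set"
  let ?X = "{(x, y, z, d). d = 2 \<and> y = B \<and> z = C \<or> d = 0 \<and> x = a 0 \<and> y = B
      \<or> d = 2 \<and> y = B \<and> z = C'} :: e3c_vertex set"
  let ?Y = "{(x, y, z, d). d = 1 \<and> x = A \<and> z = C \<or> d = 0 \<and> x = A \<and> y = b 0
      \<or> d = 1 \<and> x = A \<and> y = b 0 \<and> z = C'} :: e3c_vertex set"
  show ?thesis
  proof (rule widely_linked_familyI[where Z = ?Z and M = ?M and X = ?X and Y = ?Y, OF k(1)])
    show "weak_link (E3C_vertices r s t) (E3C_adj r s t) (r + s + t + 6) (A, B, C, 0) (A, B, C', 1) ?Z"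
      by (rule link_imp_weak_link, rule E3C_linkI[where x = "(A, B, c 0, 0)" and
          ws = "[(t - Suc 0, (A, B, C', 0)), (1, (A, B, C', 1))]"])
        (use T N c(1) pos in
          \<open>auto simp: E3C_adj_iff intro!: leg0[OF c(2)] legs\<close>)
    show "lnk (A, B, C, 0) (A, B, C', 1) (?M i)" if "0 < i" "i < 2 * k" for i
      by (rule E3C_linkI[where x = "(A, B, c i, 0)" and
          ws = "[(1, (A, B, c i, 1)), (s, (A, b i, c i, 1)), (1, (A, b i, c i, 0)),
          (t, (A, b i, C', 0)), (1, (A, b i, C', 1)), (1, (A, B, C', 1))]"])
        (use T N c(3)[OF that] b(1)[OF that(2)] differ_in_one_sym in
          \<open>auto simp: E3C_adj_iff intro!: legs\<close>)
    show "lnk (A, B, C, 0) (A, B, C', 1) ?X"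
      by (rule E3C_linkI[where x = "(A, B, C, 2)" and
          ws = "[(1, (a 0, B, C, 2)), (1, (a 0, B, C, 0)), (t, (a 0, B, C', 0)),
          (1, (a 0, B, C', 2)), (1, (A, B, C', 2)), (1, (A, B, C', 1))]"])
        (use T N a differ_in_one_sym in
          \<open>auto simp: E3C_adj_iff intro!: legs\<close>)
    show "lnk (A, B, C, 0) (A, B, C', 1) ?Y"
      by (rule E3C_linkI[where x = "(A, B, C, 1)" and
          ws = "[(1, (A, b 0, C, 1)), (1, (A, b 0, C, 0)), (t, (A, b 0, C', 0)),
          (1, (A, b 0, C', 1)), (1, (A, B, C', 1))]"])
        (use T N b0 differ_in_one_sym in
          \<open>auto simp: E3C_adj_iff intro!: legs\<close>)
    show "?Z \<inter> ?M i = {}" "?M i \<inter> ?X = {}" "?M i \<inter> ?Y = {}" if "0 < i" "i < 2 * k" for i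
      using N a c(3)[OF that] b(1)[OF that(2)] b0 b(2)[OF that] by auto
    show "?Z \<inter> ?X = {}" "?Z \<inter> ?Y = {}" "?X \<inter> ?Y = {}"
      using N a b0 c(1) by auto
    show "?M i \<inter> ?M j = {}" if "0 < i" "i < j" "j < 2 * k" for i j
      using N c(3)[of i] b(1)[of i] c(3)[of j] b(1)[of j] c(5)[OF that] b(2)[OF that(2,3)] that by auto
  qed
qed

text \<open>The ends are joined by a switch, so the member with empty support is that edge.
  \<open>?X\<close> goes round the triangle through layer 2, and \<open>?Y\<close> has the shape
  that \<open>?M\<close> would have at index 0.\<close>

lemma wide01_all_eq:
  assumes T: "ternary r A" "ternary s B" "ternary t C"
  shows "wide (A, B, C, 0) (A, B, C, 1)"
proof -
  obtain c where "hneighbours k t C c" using hneighbours_exists[OF T(3) k(4)] .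
  note c = hneighboursD[OF this]
  obtain b where "hneighbours k s B b" using hneighbours_exists[OF T(2) k(3)] .
  note b = hneighboursD[OF this]
  note c0 = c(1)[OF pos(4)] and b0 = b(1)[OF pos(4)]
  let ?Z = "{}"
  let ?M = "\<lambda>i. {(x, y, z, d). d = 0 \<and> x = A \<and> y = B \<and> z = c i
      \<or> d = 1 \<and> x = A \<and> z = c i \<or> d = 0 \<and> x = A \<and> y = b i
      \<or> d = 1 \<and> x = A \<and> y = b i \<and> z = C} :: e3c_vertex set"
  let ?X = "{(x, y, z, d). d = 2 \<and> x = A \<and> y = B \<and> z = C} :: e3c_vertex set"
  let ?Y = "{(x, y, z, d). d = 0 \<and> x = A \<and> y = B \<and> z = c 0
      \<or> d = 1 \<and> x = A \<and> z = c 0 \<or> d = 0 \<and> x = A \<and> y = b 0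
      \<or> d = 1 \<and> x = A \<and> y = b 0 \<and> z = C} :: e3c_vertex set"
  show ?thesis
  proof (rule widely_linked_familyI[where Z = ?Z and M = ?M and X = ?X and Y = ?Y, OF k(1)])
    show "weak_link (E3C_vertices r s t) (E3C_adj r s t) (r + s + t + 6) (A, B, C, 0) (A, B, C, 1) ?Z"
      by (rule weak_linkI_edge[OF E3C_adj_vertices]) (use T in \<open>auto simp: E3C_adj_iff\<close>)
    show "lnk (A, B, C, 0) (A, B, C, 1) (?M i)" if "0 < i" "i < 2 * k" for i
      by (rule E3C_linkI[where x = "(A, B, c i, 0)" and
          ws = "[(1, (A, B, c i, 1)), (s, (A, b i, c i, 1)), (1, (A, b i, c i, 0)),
          (t, (A, b i, C, 0)), (1, (A, b i, C, 1)), (1, (A, B, C, 1))]"])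
        (use T c(1)[OF that(2)] b(1)[OF that(2)] differ_in_one_sym in
          \<open>auto simp: E3C_adj_iff intro!: legs\<close>)
    show "lnk (A, B, C, 0) (A, B, C, 1) ?X"
      by (rule E3C_linkI[where x = "(A, B, C, 2)" and
          ws = "[(1, (A, B, C, 1))]"])
        (use T in
          \<open>auto simp: E3C_adj_iff intro!: legs\<close>)
    show "lnk (A, B, C, 0) (A, B, C, 1) ?Y"
      by (rule E3C_linkI[where x = "(A, B, c 0, 0)" and
          ws = "[(1, (A, B, c 0, 1)), (s, (A, b 0, c 0, 1)), (1, (A, b 0, c 0, 0)),
          (t, (A, b 0, C, 0)), (1, (A, b 0, C, 1)), (1, (A, B, C, 1))]"])
        (use T c0 b0 differ_in_one_sym in
          \<open>auto simp: E3C_adj_iff intro!: legs\<close>)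
    show "?Z \<inter> ?M i = {}" "?M i \<inter> ?X = {}" "?M i \<inter> ?Y = {}" if "0 < i" "i < 2 * k" for i
      using c(1)[OF that(2)] b(1)[OF that(2)] c0 b0 c(2)[OF that] b(2)[OF that] by auto
    show "?Z \<inter> ?X = {}" "?Z \<inter> ?Y = {}" "?X \<inter> ?Y = {}"
      using c0 b0 by auto
    show "?M i \<inter> ?M j = {}" if "0 < i" "i < j" "j < 2 * k" for i j
      using c(1)[of i] b(1)[of i] c(1)[of j] b(1)[of j] c(2)[OF that(2,3)] b(2)[OF that(2,3)] that by auto
  qed
qed

section \<open>Both endpoints in layer 0\<close>

lemma wide00_A_B_eq:
  assumes T: "ternary r A" "ternary s B" "ternary t C" "ternary t C'"
    and N: "C \<noteq> C'"
  shows "wide (A, B, C, 0) (A, B, C', 0)"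
proof -
  obtain c Q where "hpaths k t C C' c Q"
    using hpaths_exists[OF T(3) T(4) N k(4) k(1)] .
  note c = hpathsD[OF this]
  obtain b where "hneighbours k s B b" using hneighbours_exists[OF T(2) k(3)] .
  note b = hneighboursD[OF this]
  obtain a where "hneighbours k r A a" using hneighbours_exists[OF T(1) k(2)] .
  note a = hneighboursD[OF this]
  note b = b(1)[OF pos(4)] and a = a(1)[OF pos(4)]
  \<comment> \<open>The Hamming fan of the third string already gives \<open>2 * k\<close> paths on
    the line at \<open>(A, B)\<close>. \<open>?X\<close> and \<open>?Y\<close> avoid this line by
    crossing at \<open>(A, b 0)\<close> and \<open>(a 0, B)\<close>.\<close>
  let ?Z = "{(x, y, z, d). d = 0 \<and> x = A \<and> y = B \<and> z \<in> Q 0} :: e3c_vertex set"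
  let ?M = "\<lambda>i. {(x, y, z, d). d = 0 \<and> x = A \<and> y = B \<and> z \<in> Q i} :: e3c_vertex set"
  let ?X = "{(x, y, z, d). d = 1 \<and> x = A \<and> z = C \<or> d = 0 \<and> x = A \<and> y = b 0
      \<or> d = 1 \<and> x = A \<and> z = C'} :: e3c_vertex set"
  let ?Y = "{(x, y, z, d). d = 2 \<and> y = B \<and> z = C \<or> d = 0 \<and> x = a 0 \<and> y = B
      \<or> d = 2 \<and> y = B \<and> z = C'} :: e3c_vertex set"
  show ?thesis
  proof (rule widely_linked_familyI[where Z = ?Z and M = ?M and X = ?X and Y = ?Y, OF k(1)])
    show "weak_link (E3C_vertices r s t) (E3C_adj r s t) (r + s + t + 6) (A, B, C, 0) (A, B, C', 0) ?Z"
    \<comment> \<open>If \<open>c 0 = C'\<close>, path 0 of the fan is a single edge with empty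
      interior.\<close>
    proof (cases "c 0 = C'")
      case True
      then show ?thesis
        by (intro weak_linkI_edge[OF E3C_adj_vertices]) (use T N c(1) in \<open>auto simp: E3C_adj_iff\<close>)
    next
      case False
      then show ?thesis
        by (intro link_imp_weak_link, intro E3C_linkI[where x = "(A, B, c 0, 0)" and
            ws = "[(t - Suc 0, (A, B, C', 0))]"])
          (use T N c(1) pos in \<open>auto simp: E3C_adj_iff intro!: leg0[OF c(2)]\<close>)
    qed
    show "lnk (A, B, C, 0) (A, B, C', 0) (?M i)" if "0 < i" "i < 2 * k" for i
      by (rule E3C_linkI[where x = "(A, B, c i, 0)" and
          ws = "[(t, (A, B, C', 0))]"])
        (use T N c(3)[OF that] in
          \<open>auto simp: E3C_adj_iff intro!: leg0[OF c(4)[OF that]]\<close>)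
    show "lnk (A, B, C, 0) (A, B, C', 0) ?X"
      by (rule E3C_linkI[where x = "(A, B, C, 1)" and
          ws = "[(1, (A, b 0, C, 1)), (1, (A, b 0, C, 0)), (t, (A, b 0, C', 0)),
          (1, (A, b 0, C', 1)), (1, (A, B, C', 1)), (1, (A, B, C', 0))]"])
        (use T N b differ_in_one_sym in
          \<open>auto simp: E3C_adj_iff intro!: legs\<close>)
    show "lnk (A, B, C, 0) (A, B, C', 0) ?Y"
      by (rule E3C_linkI[where x = "(A, B, C, 2)" and
          ws = "[(1, (a 0, B, C, 2)), (1, (a 0, B, C, 0)), (t, (a 0, B, C', 0)),
          (1, (a 0, B, C', 2)), (1, (A, B, C', 2)), (1, (A, B, C', 0))]"])
        (use T N a differ_in_one_sym in
          \<open>auto simp: E3C_adj_iff intro!: legs\<close>)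
    show "?Z \<inter> ?M i = {}" "?M i \<inter> ?X = {}" "?M i \<inter> ?Y = {}" if "0 < i" "i < 2 * k" for i
      using N a b c(3)[OF that] by auto
    show "?Z \<inter> ?X = {}" "?Z \<inter> ?Y = {}" "?X \<inter> ?Y = {}"
      using N a b c(1) by auto
    show "?M i \<inter> ?M j = {}" if "0 < i" "i < j" "j < 2 * k" for i j
      using N c(5)[OF that] that by auto
  qed
qed

text \<open>The fan is used at both ends. At \<open>(A, B)\<close> its path 0 serves
  \<open>?Z\<close> and the \<open>?M i\<close> take only the vertices \<open>c i\<close>; at
  \<open>(A', B')\<close> the \<open>?M i\<close> finish along \<open>Q i\<close> and
  \<open>?Y\<close> along \<open>Q 0\<close>. In exchange \<open>?Z\<close> and \<open>?X\<close>
  enter the end by the switches from layers 1 and 2.\<close>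

lemma wide00_all_differ:
  assumes T: "ternary r A" "ternary r A'" "ternary s B" "ternary s B'" "ternary t C" "ternary t C'"
    and N: "A \<noteq> A'" "B \<noteq> B'" "C \<noteq> C'"
  shows "wide (A, B, C, 0) (A', B', C', 0)"
proof -
  obtain c Q where "hpaths k t C C' c Q"
    using hpaths_exists[OF T(5) T(6) N(3) k(4) k(1)] .
  note c = hpathsD[OF this]
  let ?Z = "{(x, y, z, d). d = 0 \<and> x = A \<and> y = B \<and> z \<in> insert C' (Q 0)
      \<or> d = 2 \<and> y = B \<and> z = C'
      \<or> d = 1 \<and> x = A' \<and> z = C'} :: e3c_vertex set"
  let ?M = "\<lambda>i. {(x, y, z, d). d = 0 \<and> x = A \<and> y = B \<and> z = c i
      \<or> d = 1 \<and> x = A \<and> z = c i \<or> d = 2 \<and> y = B' \<and> z = c i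
      \<or> d = 0 \<and> x = A' \<and> y = B' \<and> z \<in> Q i} :: e3c_vertex set"
  let ?X = "{(x, y, z, d). d = 1 \<and> x = A \<and> z = C \<or> d = 0 \<and> x = A \<and> y = B'
      \<or> d = 2 \<and> y = B' \<and> z = C'} :: e3c_vertex set"
  let ?Y = "{(x, y, z, d). d = 2 \<and> y = B \<and> z = C \<or> d = 1 \<and> x = A' \<and> z = C
      \<or> d = 0 \<and> x = A' \<and> y = B' \<and> z \<in> insert C (Q 0)} :: e3c_vertex set"
  show ?thesis
  proof (rule widely_linked_familyI[where Z = ?Z and M = ?M and X = ?X and Y = ?Y, OF k(1)])
    show "weak_link (E3C_vertices r s t) (E3C_adj r s t) (r + s + t + 6) (A, B, C, 0) (A', B', C', 0) ?Z"
      by (rule link_imp_weak_link, rule E3C_linkI[where x = "(A, B, c 0, 0)" and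
          ws = "[(t - Suc 0, (A, B, C', 0)), (1, (A, B, C', 2)), (r, (A', B, C', 2)),
          (1, (A', B, C', 1)), (s, (A', B', C', 1)), (1, (A', B', C', 0))]"])
        (use T N c(1) pos in
          \<open>auto simp: E3C_adj_iff intro!: leg0[OF c(2)] legs\<close>)
    show "lnk (A, B, C, 0) (A', B', C', 0) (?M i)" if "0 < i" "i < 2 * k" for i
      by (rule E3C_linkI[where x = "(A, B, c i, 0)" and
          ws = "[(1, (A, B, c i, 1)), (s, (A, B', c i, 1)), (1, (A, B', c i, 2)),
          (r, (A', B', c i, 2)), (1, (A', B', c i, 0)), (t, (A', B', C', 0))]"])
        (use T N c(3)[OF that] in
          \<open>auto simp: E3C_adj_iff intro!: leg0[OF c(4)[OF that]] partial_legs\<close>)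
    show "lnk (A, B, C, 0) (A', B', C', 0) ?X"
      by (rule E3C_linkI[where x = "(A, B, C, 1)" and
          ws = "[(s, (A, B', C, 1)), (1, (A, B', C, 0)), (t, (A, B', C', 0)), (1, (A, B', C', 2)),
          (r, (A', B', C', 2)), (1, (A', B', C', 0))]"])
        (use T N in
          \<open>auto simp: E3C_adj_iff intro!: legs\<close>)
    show "lnk (A, B, C, 0) (A', B', C', 0) ?Y"
      by (rule E3C_linkI[where x = "(A, B, C, 2)" and
          ws = "[(r, (A', B, C, 2)), (1, (A', B, C, 1)), (s, (A', B', C, 1)), (1, (A', B', C, 0)),
          (t, (A', B', C', 0))]"])
        (use T N c(1) pos in
          \<open>auto simp: E3C_adj_iff intro!: leg0[OF c(6)] partial_legs\<close>)
    show "?Z \<inter> ?M i = {}" "?M i \<inter> ?X = {}" "?M i \<inter> ?Y = {}" if "0 < i" "i < 2 * k" for i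
      using N c(1) c(3)[OF that] by auto
    show "?Z \<inter> ?X = {}" "?Z \<inter> ?Y = {}" "?X \<inter> ?Y = {}"
      using N c(1) by auto
    show "?M i \<inter> ?M j = {}" if "0 < i" "i < j" "j < 2 * k" for i j
      using N c(3)[of i] c(3)[of j] c(5)[OF that] that by auto
  qed
qed

text \<open>\<open>?X\<close> and \<open>?Y\<close> keep \<open>C\<close> and change the other two
  strings in the two possible orders. The other paths do so at the parallel strings
  \<open>c i\<close>, from which one step leads back to \<open>C\<close>.\<close>

lemma wide00_C_eq:
  assumes T: "ternary r A" "ternary r A'" "ternary s B" "ternary s B'" "ternary t C"
    and N: "A \<noteq> A'" "B \<noteq> B'"
  shows "wide (A, B, C, 0) (A', B', C, 0)"
proof -
  obtain c where "hneighbours k t C c" using hneighbours_exists[OF T(5) k(4)] .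
  note c = hneighboursD[OF this]
  note c0 = c(1)[OF pos(4)]
  let ?Z = "{(x, y, z, d). d = 0 \<and> x = A \<and> y = B \<and> z = c 0
      \<or> d = 1 \<and> x = A \<and> z = c 0 \<or> d = 2 \<and> y = B' \<and> z = c 0
      \<or> d = 0 \<and> x = A' \<and> y = B' \<and> z = c 0} :: e3c_vertex set"
  let ?M = "\<lambda>i. {(x, y, z, d). d = 0 \<and> x = A \<and> y = B \<and> z = c i
      \<or> d = 1 \<and> x = A \<and> z = c i \<or> d = 2 \<and> y = B' \<and> z = c i
      \<or> d = 0 \<and> x = A' \<and> y = B' \<and> z = c i} :: e3c_vertex set"
  let ?X = "{(x, y, z, d). d = 1 \<and> x = A \<and> z = C
      \<or> d = 2 \<and> y = B' \<and> z = C} :: e3c_vertex set"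
  let ?Y = "{(x, y, z, d). d = 2 \<and> y = B \<and> z = C
      \<or> d = 1 \<and> x = A' \<and> z = C} :: e3c_vertex set"
  show ?thesis
  proof (rule widely_linked_familyI[where Z = ?Z and M = ?M and X = ?X and Y = ?Y, OF k(1)])
    show "weak_link (E3C_vertices r s t) (E3C_adj r s t) (r + s + t + 6) (A, B, C, 0) (A', B', C, 0) ?Z"
      by (rule link_imp_weak_link, rule E3C_linkI[where x = "(A, B, c 0, 0)" and
          ws = "[(1, (A, B, c 0, 1)), (s, (A, B', c 0, 1)), (1, (A, B', c 0, 2)),
          (r, (A', B', c 0, 2)), (1, (A', B', c 0, 0)), (1, (A', B', C, 0))]"])
        (use T N c0 differ_in_one_sym in
          \<open>auto simp: E3C_adj_iff intro!: legs\<close>)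
    show "lnk (A, B, C, 0) (A', B', C, 0) (?M i)" if "0 < i" "i < 2 * k" for i
      by (rule E3C_linkI[where x = "(A, B, c i, 0)" and
          ws = "[(1, (A, B, c i, 1)), (s, (A, B', c i, 1)), (1, (A, B', c i, 2)),
          (r, (A', B', c i, 2)), (1, (A', B', c i, 0)), (1, (A', B', C, 0))]"])
        (use T N c(1)[OF that(2)] differ_in_one_sym in
          \<open>auto simp: E3C_adj_iff intro!: legs\<close>)
    show "lnk (A, B, C, 0) (A', B', C, 0) ?X"
      by (rule E3C_linkI[where x = "(A, B, C, 1)" and
          ws = "[(s, (A, B', C, 1)), (1, (A, B', C, 2)), (r, (A', B', C, 2)), (1, (A', B', C, 0))]"])
        (use T N in
          \<open>auto simp: E3C_adj_iff intro!: legs\<close>)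
    show "lnk (A, B, C, 0) (A', B', C, 0) ?Y"
      by (rule E3C_linkI[where x = "(A, B, C, 2)" and
          ws = "[(r, (A', B, C, 2)), (1, (A', B, C, 1)), (s, (A', B', C, 1)), (1, (A', B', C, 0))]"])
        (use T N in
          \<open>auto simp: E3C_adj_iff intro!: legs\<close>)
    show "?Z \<inter> ?M i = {}" "?M i \<inter> ?X = {}" "?M i \<inter> ?Y = {}" if "0 < i" "i < 2 * k" for i
      using N c0 c(1)[OF that(2)] c(2)[OF that] by auto
    show "?Z \<inter> ?X = {}" "?Z \<inter> ?Y = {}" "?X \<inter> ?Y = {}"
      using N c0 by auto
    show "?M i \<inter> ?M j = {}" if "0 < i" "i < j" "j < 2 * k" for i j
      using N c(1)[of i] c(1)[of j] c(2)[OF that(2,3)] that by auto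
  qed
qed

text \<open>After its switch to layer 1, \<open>?Y\<close> can only move the second string, hence
  the detour over \<open>b 0\<close>; it is undone in layer 1 at \<open>A'\<close>, away from the
  lines at \<open>B\<close> in layers 0 and 2 that the other paths use.\<close>

lemma wide00_B_eq:
  assumes T: "ternary r A" "ternary r A'" "ternary s B" "ternary t C" "ternary t C'"
    and N: "A \<noteq> A'" "C \<noteq> C'"
  shows "wide (A, B, C, 0) (A', B, C', 0)"
proof -
  obtain c Q where "hpaths k t C C' c Q"
    using hpaths_exists[OF T(4) T(5) N(2) k(4) k(1)] .
  note c = hpathsD[OF this]
  obtain b where "hneighbours k s B b" using hneighbours_exists[OF T(3) k(3)] .
  note b = hneighboursD[OF this]
  note b = b(1)[OF pos(4)]
  let ?Z = "{(x, y, z, d). d = 0 \<and> x = A \<and> y = B \<and> z \<in> insert C' (Q 0)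
      \<or> d = 2 \<and> y = B \<and> z = C'} :: e3c_vertex set"
  let ?M = "\<lambda>i. {(x, y, z, d). d = 0 \<and> x = A \<and> y = B \<and> z = c i
      \<or> d = 2 \<and> y = B \<and> z = c i
      \<or> d = 0 \<and> x = A' \<and> y = B \<and> z \<in> Q i} :: e3c_vertex set"
  let ?X = "{(x, y, z, d). d = 2 \<and> y = B \<and> z = C
      \<or> d = 0 \<and> x = A' \<and> y = B \<and> z \<in> insert C (Q 0)} :: e3c_vertex set"
  let ?Y = "{(x, y, z, d). d = 1 \<and> x = A \<and> z = C \<or> d = 0 \<and> x = A \<and> y = b 0
      \<or> d = 2 \<and> y = b 0 \<and> z = C'
      \<or> d = 1 \<and> x = A' \<and> z = C'} :: e3c_vertex set"
  show ?thesis
  proof (rule widely_linked_familyI[where Z = ?Z and M = ?M and X = ?X and Y = ?Y, OF k(1)])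
    show "weak_link (E3C_vertices r s t) (E3C_adj r s t) (r + s + t + 6) (A, B, C, 0) (A', B, C', 0) ?Z"
      by (rule link_imp_weak_link, rule E3C_linkI[where x = "(A, B, c 0, 0)" and
          ws = "[(t - Suc 0, (A, B, C', 0)), (1, (A, B, C', 2)), (r, (A', B, C', 2)),
          (1, (A', B, C', 0))]"])
        (use T N c(1) pos in
          \<open>auto simp: E3C_adj_iff intro!: leg0[OF c(2)] legs\<close>)
    show "lnk (A, B, C, 0) (A', B, C', 0) (?M i)" if "0 < i" "i < 2 * k" for i
      by (rule E3C_linkI[where x = "(A, B, c i, 0)" and
          ws = "[(1, (A, B, c i, 2)), (r, (A', B, c i, 2)), (1, (A', B, c i, 0)),
          (t, (A', B, C', 0))]"])
        (use T N c(3)[OF that] in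
          \<open>auto simp: E3C_adj_iff intro!: leg0[OF c(4)[OF that]] partial_legs\<close>)
    show "lnk (A, B, C, 0) (A', B, C', 0) ?X"
      by (rule E3C_linkI[where x = "(A, B, C, 2)" and
          ws = "[(r, (A', B, C, 2)), (1, (A', B, C, 0)), (t, (A', B, C', 0))]"])
        (use T N c(1) pos in
          \<open>auto simp: E3C_adj_iff intro!: leg0[OF c(6)] partial_legs\<close>)
    \<comment> \<open>Seven steps besides \<open>r + t\<close>, within the bound because
      \<open>s \<ge> 1\<close>.\<close>
    show "lnk (A, B, C, 0) (A', B, C', 0) ?Y"
      by (rule E3C_linkI[where x = "(A, B, C, 1)" and
          ws = "[(1, (A, b 0, C, 1)), (1, (A, b 0, C, 0)), (t, (A, b 0, C', 0)),
          (1, (A, b 0, C', 2)), (r, (A', b 0, C', 2)), (1, (A', b 0, C', 1)),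
          (1, (A', B, C', 1)), (1, (A', B, C', 0))]"])
        (use T N b pos differ_in_one_sym in
          \<open>auto simp: E3C_adj_iff intro!: legs\<close>)
    show "?Z \<inter> ?M i = {}" "?M i \<inter> ?X = {}" "?M i \<inter> ?Y = {}" if "0 < i" "i < 2 * k" for i
      using N b c(1) c(3)[OF that] by auto
    show "?Z \<inter> ?X = {}" "?Z \<inter> ?Y = {}" "?X \<inter> ?Y = {}"
      using N b c(1) by auto
    show "?M i \<inter> ?M j = {}" if "0 < i" "i < j" "j < 2 * k" for i j
      using N c(3)[of i] c(3)[of j] c(5)[OF that] that by auto
  qed
qed

text \<open>Again the paths cross layer 2 on parallel lines: at \<open>(B, c i)\<close>, at
  \<open>(B, C)\<close> and at \<open>(b 0, C)\<close>.\<close>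

lemma wide00_B_C_eq:
  assumes T: "ternary r A" "ternary r A'" "ternary s B" "ternary t C"
    and N: "A \<noteq> A'"
  shows "wide (A, B, C, 0) (A', B, C, 0)"
proof -
  obtain c where "hneighbours k t C c" using hneighbours_exists[OF T(4) k(4)] .
  note c = hneighboursD[OF this]
  obtain b where "hneighbours k s B b" using hneighbours_exists[OF T(3) k(3)] .
  note b = hneighboursD[OF this]
  note c0 = c(1)[OF pos(4)] and b = b(1)[OF pos(4)]
  let ?Z = "{(x, y, z, d). d = 0 \<and> x = A \<and> y = B \<and> z = c 0
      \<or> d = 2 \<and> y = B \<and> z = c 0
      \<or> d = 0 \<and> x = A' \<and> y = B \<and> z = c 0} :: e3c_vertex set"
  let ?M = "\<lambda>i. {(x, y, z, d). d = 0 \<and> x = A \<and> y = B \<and> z = c i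
      \<or> d = 2 \<and> y = B \<and> z = c i
      \<or> d = 0 \<and> x = A' \<and> y = B \<and> z = c i} :: e3c_vertex set"
  let ?X = "{(x, y, z, d). d = 2 \<and> y = B \<and> z = C} :: e3c_vertex set"
  let ?Y = "{(x, y, z, d). d = 1 \<and> x = A \<and> z = C \<or> d = 2 \<and> y = b 0 \<and> z = C
      \<or> d = 1 \<and> x = A' \<and> z = C} :: e3c_vertex set"
  show ?thesis
  proof (rule widely_linked_familyI[where Z = ?Z and M = ?M and X = ?X and Y = ?Y, OF k(1)])
    show "weak_link (E3C_vertices r s t) (E3C_adj r s t) (r + s + t + 6) (A, B, C, 0) (A', B, C, 0) ?Z"
      by (rule link_imp_weak_link, rule E3C_linkI[where x = "(A, B, c 0, 0)" and
          ws = "[(1, (A, B, c 0, 2)), (r, (A', B, c 0, 2)), (1, (A', B, c 0, 0)),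
          (1, (A', B, C, 0))]"])
        (use T N c0 differ_in_one_sym in
          \<open>auto simp: E3C_adj_iff intro!: legs\<close>)
    show "lnk (A, B, C, 0) (A', B, C, 0) (?M i)" if "0 < i" "i < 2 * k" for i
      by (rule E3C_linkI[where x = "(A, B, c i, 0)" and
          ws = "[(1, (A, B, c i, 2)), (r, (A', B, c i, 2)), (1, (A', B, c i, 0)),
          (1, (A', B, C, 0))]"])
        (use T N c(1)[OF that(2)] differ_in_one_sym in
          \<open>auto simp: E3C_adj_iff intro!: legs\<close>)
    show "lnk (A, B, C, 0) (A', B, C, 0) ?X"
      by (rule E3C_linkI[where x = "(A, B, C, 2)" and
          ws = "[(r, (A', B, C, 2)), (1, (A', B, C, 0))]"])
        (use T N in
          \<open>auto simp: E3C_adj_iff intro!: legs\<close>)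
    show "lnk (A, B, C, 0) (A', B, C, 0) ?Y"
      by (rule E3C_linkI[where x = "(A, B, C, 1)" and
          ws = "[(1, (A, b 0, C, 1)), (1, (A, b 0, C, 2)), (r, (A', b 0, C, 2)),
          (1, (A', b 0, C, 1)), (1, (A', B, C, 1)), (1, (A', B, C, 0))]"])
        (use T N b pos differ_in_one_sym in
          \<open>auto simp: E3C_adj_iff intro!: legs\<close>)
    show "?Z \<inter> ?M i = {}" "?M i \<inter> ?X = {}" "?M i \<inter> ?Y = {}" if "0 < i" "i < 2 * k" for i
      using N b c0 c(1)[OF that(2)] c(2)[OF that] by auto
    show "?Z \<inter> ?X = {}" "?Z \<inter> ?Y = {}" "?X \<inter> ?Y = {}"
      using N b c0 by auto
    show "?M i \<inter> ?M j = {}" if "0 < i" "i < j" "j < 2 * k" for i j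
      using N c(1)[of i] c(1)[of j] c(2)[OF that(2,3)] that by auto
  qed
qed

end

section \<open>Exchanging layers\<close>

text \<open>Layer 0 moves the third string and layer 1 the second, so exchanging these layers has to
  exchange the two strings and with them the parameters \<open>s\<close> and
  \<open>t\<close>.\<close>

fun swap01 :: "e3c_vertex \<Rightarrow> e3c_vertex" where
  "swap01 (a, b, c, d) = (a, c, b, if d = 0 then 1 else if d = 1 then 0 else d)"

fun swap12 :: "e3c_vertex \<Rightarrow> e3c_vertex" where
  "swap12 (a, b, c, d) = (b, a, c, if d = 1 then 2 else if d = 2 then 1 else d)"

lemma swap01_swap01: "swap01 (swap01 x) = x"
  by (cases x) auto

lemma swap12_swap12: "swap12 (swap12 x) = x"
  by (cases x) auto

lemma E3C_wide_swap01:
  assumes "E3C_wide k r t s (swap01 u) (swap01 v)"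
  shows "E3C_wide k r s t u v"
proof -
  have "inj swap01" by (metis injI swap01_swap01)
  moreover have "swap01 x \<in> E3C_vertices r s t" if "x \<in> E3C_vertices r t s" for x
    using that by (cases x) (auto simp: E3C_vertices_def)
  moreover have "E3C_adj r s t (swap01 x) (swap01 y)" if "E3C_adj r t s x y" for x y
    using that by (cases x; cases y) (auto simp: E3C_adj_iff)
  ultimately have "widely_linked (E3C_vertices r s t) (E3C_adj r s t) (2 * k + 2) (r + t + s + 6)
      (swap01 (swap01 u)) (swap01 (swap01 v))"
    using assms by (rule widely_linked_map)
  then show ?thesis by (simp add: swap01_swap01 add.commute add.left_commute)
qed

lemma E3C_wide_swap12:
  assumes "E3C_wide k s r t (swap12 u) (swap12 v)"
  shows "E3C_wide k r s t u v"
proof -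
  have "inj swap12" by (metis injI swap12_swap12)
  moreover have "swap12 x \<in> E3C_vertices r s t" if "x \<in> E3C_vertices s r t" for x
    using that by (cases x) (auto simp: E3C_vertices_def)
  moreover have "E3C_adj r s t (swap12 x) (swap12 y)" if "E3C_adj s r t x y" for x y
    using that by (cases x; cases y) (auto simp: E3C_adj_iff)
  ultimately have "widely_linked (E3C_vertices r s t) (E3C_adj r s t) (2 * k + 2) (s + r + t + 6)
      (swap12 (swap12 u)) (swap12 (swap12 v))"
    using assms by (rule widely_linked_map)
  then show ?thesis by (simp add: swap12_swap12 add.commute)
qed

lemma E3C_wide_sym: "E3C_wide k r s t u v \<Longrightarrow> E3C_wide k r s t v u"
  by (rule widely_linked_sym[OF E3C_adj_sym])

section \<open>Reduction of all pairs of vertices to the families above\<close>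

context e3c
begin

lemma wide00:
  assumes T: "ternary r A" "ternary r A'" "ternary s B" "ternary s B'" "ternary t C" "ternary t C'"
    and N: "(A, B, C) \<noteq> (A', B', C')"
  shows "wide (A, B, C, 0) (A', B', C', 0)"
proof -
  interpret S: e3c s r t k using k by unfold_locales
  consider "A = A'" "B = B'" "C \<noteq> C'" | "A \<noteq> A'" "B \<noteq> B'" "C \<noteq> C'" | "A \<noteq> A'" "B \<noteq> B'" "C = C'"
    | "A \<noteq> A'" "B = B'" "C \<noteq> C'" | "A \<noteq> A'" "B = B'" "C = C'"
    | "A = A'" "B \<noteq> B'" "C \<noteq> C'" | "A = A'" "B \<noteq> B'" "C = C'"
    using N by auto
  then show ?thesis
  proof cases
    case 1 then show ?thesis using wide00_A_B_eq T by simp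
  next
    case 2 then show ?thesis using wide00_all_differ T by simp
  next
    case 3 then show ?thesis using wide00_C_eq T by simp
  next
    case 4 then show ?thesis using wide00_B_eq T by simp
  next
    case 5 then show ?thesis using wide00_B_C_eq T by simp
  next
    case 6 then show ?thesis using S.wide00_B_eq T by - (rule E3C_wide_swap12, simp)
  next
    case 7 then show ?thesis using S.wide00_B_C_eq T by - (rule E3C_wide_swap12, simp)
  qed
qed

lemma wide01:
  assumes T: "ternary r A" "ternary r A'" "ternary s B" "ternary s B'" "ternary t C" "ternary t C'"
  shows "wide (A, B, C, 0) (A', B', C', 1)"
proof -
  interpret S: e3c r t s k using k by unfold_locales
  \<comment> \<open>Exchanging layers 0 and 1 puts the start in layer 1 and the end in layer 0, so
    the family is also reversed. The cases with \<open>B \<noteq> B'\<close> and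
    \<open>C = C'\<close> turn into ones whose second strings agree.\<close>
  note swap = E3C_wide_sym[THEN E3C_wide_swap01]
  show ?thesis
  proof (cases "B = B'"; cases "C = C'"; cases "A = A'")
    assume "B = B'" "C = C'" "A = A'"
    then show ?thesis using wide01_all_eq T by simp
  next
    assume "B = B'" "C = C'" "A \<noteq> A'"
    then show ?thesis using wide01_B_C_eq T by simp
  next
    assume "B = B'" "C \<noteq> C'" "A = A'"
    then show ?thesis using wide01_A_B_eq T by simp
  next
    assume "B = B'" "C \<noteq> C'" "A \<noteq> A'"
    then show ?thesis using wide01_B_eq T by simp
  next
    assume "B \<noteq> B'" "C = C'" "A = A'"
    then show ?thesis using S.wide01_A_B_eq[of A C B' B] T by - (rule swap, simp)
  next
    assume "B \<noteq> B'" "C = C'" "A \<noteq> A'"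
    then show ?thesis using S.wide01_B_eq[of A' A C B' B] T by - (rule swap, simp)
  next
    assume "B \<noteq> B'" "C \<noteq> C'" "A = A'"
    then show ?thesis using wide01_A_eq T by simp
  next
    assume "B \<noteq> B'" "C \<noteq> C'" "A \<noteq> A'"
    then show ?thesis using wide01_all_differ T by simp
  qed
qed

end

lemma E3C_wide_distinct:
  assumes k: "1 \<le> k" "k \<le> r" "k \<le> s" "k \<le> t"
    and "u \<in> E3C_vertices r s t" "v \<in> E3C_vertices r s t" "u \<noteq> v"
  shows "E3C_wide k r s t u v"
proof -
  obtain A B C d A' B' C' d' where uv: "u = (A, B, C, d)" "v = (A', B', C', d')"
    by (metis prod_cases4)
  have T: "ternary r A" "ternary r A'" "ternary s B" "ternary s B'" "ternary t C" "ternary t C'"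
    and d: "d = 0 \<or> d = 1 \<or> d = 2" "d' = 0 \<or> d' = 1 \<or> d' = 2"
    using assms(5,6) uv by (auto simp: E3C_vertices_def)
  interpret e3c r s t k using k by unfold_locales
  interpret S01: e3c r t s k using k by unfold_locales
  interpret S12: e3c s r t k using k by unfold_locales
  interpret R: e3c t r s k using k by unfold_locales
  interpret R': e3c s t r k using k by unfold_locales
  have same: ?thesis if "d = d'"
  proof -
    have N: "(A, B, C) \<noteq> (A', B', C')" "(A, C, B) \<noteq> (A', C', B')" "(B, C, A) \<noteq> (B', C', A')"
      using assms(7) uv that by auto
    from d(1) show ?thesis
    proof (elim disjE)
      assume "d = 0"
      then show ?thesis using wide00[OF T N(1)] uv that by simp
    next
      assume "d = 1"
      then show ?thesis using S01.wide00[OF T(1,2,5,6,3,4) N(2)] uv that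
        by - (rule E3C_wide_swap01, simp)
    next
      \<comment> \<open>Layer 2 is carried first to layer 1 and then to layer 0, which permutes the
        strings cyclically.\<close>
      assume "d = 2"
      then show ?thesis using R'.wide00[OF T(3-6,1,2) N(3)] uv that
        by - (rule E3C_wide_swap12, rule E3C_wide_swap01, simp)
    qed
  qed
  have w01: "E3C_wide k r s t (X, Y, Z, 0) (X', Y', Z', 1)"
    if "ternary r X" "ternary r X'" "ternary s Y" "ternary s Y'" "ternary t Z" "ternary t Z'"
    for X Y Z X' Y' Z' using wide01 that by blast
  have w02: "E3C_wide k r s t (X, Y, Z, 0) (X', Y', Z', 2)"
    if "ternary r X" "ternary r X'" "ternary s Y" "ternary s Y'" "ternary t Z" "ternary t Z'"
    for X Y Z X' Y' Z' using S12.wide01[of Y Y' X X' Z Z'] that by - (rule E3C_wide_swap12, simp)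
  \<comment> \<open>The layers 1, 2 become 0, 2 by the first exchange and 0, 1 by the
    second.\<close>
  have w12: "E3C_wide k r s t (X, Y, Z, 1) (X', Y', Z', 2)"
    if "ternary r X" "ternary r X'" "ternary s Y" "ternary s Y'" "ternary t Z" "ternary t Z'"
    for X Y Z X' Y' Z' using R.wide01[of Z Z' X X' Y Y'] that
    by - (rule E3C_wide_swap01, rule E3C_wide_swap12, simp)
  show ?thesis
  proof (cases "d = d'")
    case True
    then show ?thesis by (rule same)
  next
    case False
    note w = w01[OF T] w02[OF T] w12[OF T]
      E3C_wide_sym[OF w01[OF T(2,1,4,3,6,5)]] E3C_wide_sym[OF w02[OF T(2,1,4,3,6,5)]]
      E3C_wide_sym[OF w12[OF T(2,1,4,3,6,5)]]
    show ?thesis using d False unfolding uv by (elim disjE; simp only: w)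
  qed
qed

section \<open>The bound on the wide diameter\<close>

lemma finite_E3C_vertices: "finite (E3C_vertices r s t)"
proof -
  have fin: "finite {x. ternary m x}" for m
    by (rule finite_subset[OF _ finite_lists_length_eq[of "{..<3}" m]]) (auto simp: ternary_def)
  have "E3C_vertices r s t \<subseteq> {x. ternary r x} \<times> {x. ternary s x} \<times> {x. ternary t x} \<times> {..<3}"
    by (auto simp: E3C_vertices_def)
  then show ?thesis using fin by (meson finite_SigmaI finite_lessThan finite_subset)
qed

theorem theorem2:
  fixes r s t :: nat
  assumes "1 \<le> r" and "r \<le> s" and "s \<le> t"
  shows "wide_diameter (E3C_vertices r s t) (E3C_adj r s t) (2 * r + 2) \<le> r + s + t + 6"
proof (rule wide_diameter_le[OF finite_E3C_vertices])
  show "(replicate r 0, replicate s 0, replicate t 0, 0) \<in> E3C_vertices r s t"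
    "(replicate r 0, replicate s 0, replicate t 0, 1) \<in> E3C_vertices r s t"
    by (auto simp: E3C_vertices_def ternary_def)
  show "E3C_wide r r s t u v" if "u \<in> E3C_vertices r s t" "v \<in> E3C_vertices r s t" "u \<noteq> v" for u v
    using E3C_wide_distinct[of r] assms that by simp
qed simp_all

end
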